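(* Let $G_2$ be the finite directed graph with two vertices $1,2$ and three edges: one loop at vertex $1$, one edge from $1$ to $2$, and one edge from $2$ to $1$. Then $D_{G_2}^V$ is not topologically conjugate to $D_{G_2}^E$.
   Context: Markov-Dyck shift of a matrix. Let $A=[A(i,j)]_{i,j=1}^{M}$ be a $\{0,1\}$-matrix with no zero row and no zero column. Let $\mathcal O_A$ be the Cuntz-Krieger algebra, i.e. the universal $C^*$-algebra generated by partial isometries $t_1,\dots,t_M$ subject to $\sum_{j=1}^M t_jt_j^*=1$ and $t_i^*t_i=\sum_{j=1}^M A(i,j)t_jt_j^*$ for $i=1,\dots,M$. Let $\Sigma=\{\alpha_1,\dots,\alpha_M\}\cup\{\beta_1,\dots,\beta_M\}$ (disjoint), and $\varphi_A(\alpha_i)=t_i^*$, $\varphi_A(\beta_i)=t_i$. A word $\gamma_1\cdots\gamma_n$ over $\Sigma$ is forbidden if $\varphi_A(\gamma_1)\cdots\varphi_A(\gamma_n)=0$ in $\mathcal O_A$. The Markov-Dyck shift $D_A\subset\Sigma^{\mathbb Z}$ is the subshift of all bi-infinite sequences containing no forbidden word. For the graph $G_2$, the vertex matrix is $A_{G_2}=\begin{bmatrix}1&1\\1&0\end{bmatrix}$ and the edge matrix (entry $1$ when the final vertex of the $i$th edge is the initial vertex of the $j$th edge) is $A^{G_2}=\begin{bmatrix}1&1&0\\0&0&1\\1&1&0\end{bmatrix}$. The Markov-Dyck shift of vertex type is $D_{G_2}^V:=D_{A_{G_2}}$ and that of edge type is $D_{G_2}^E:=D_{A^{G_2}}$.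 Two subshifts are topologically conjugate if there is a shift-commuting homeomorphism between them. *)

theory Defs
  imports
    "HOL-Analysis.Analysis"
    "HOL-Algebra.Ring"
    "HOL-Library.Poly_Mapping"
    "Graph_Theory.Digraph"
begin

section \<open>The free unital complex *-algebra\<close>

text \<open>
  Its basis is the free monoid on the symbols \<open>Gen i\<close> (standing for $t_i$) and \<open>Adj i\<close>
  (standing for $t_i^*$).  Words form a separate type so that the free monoid can be made an
  instance of \<open>monoid_add\<close> (written additively, though it is not commutative); the product on
  finitely supported functions is then the convolution of \<open>HOL-Library.Poly_Mapping\<close>.
\<close>

datatype 'i star_symbol = Gen 'i | Adj 'i

datatype 'i star_word = Word "'i star_symbol list"

instantiation star_word :: (type) monoid_add
begin

definition zero_star_word :: "'a star_word" where
  "zero_star_word = Word []"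

fun plus_star_word :: "'a star_word \<Rightarrow> 'a star_word \<Rightarrow> 'a star_word" where
  "Word u + Word v = Word (u @ v)"

instance
proof
  fix a b c :: "'a star_word"
  show "a + b + c = a + (b + c)" by (cases a; cases b; cases c) simp
  show "0 + a = a" "a + 0 = a" by (cases a; simp add: zero_star_word_def)+
qed

end

type_synonym 'i free_star_alg = "'i star_word \<Rightarrow>\<^sub>0 complex"

fun adj_symbol :: "'i star_symbol \<Rightarrow> 'i star_symbol" where
  "adj_symbol (Gen i) = Adj i"
| "adj_symbol (Adj i) = Gen i"

fun adj_word :: "'i star_word \<Rightarrow> 'i star_word" where
  "adj_word (Word u) = Word (rev (map adj_symbol u))"

lemma adj_symbol_adj_symbol [simp]: "adj_symbol (adj_symbol s) = s"
  by (cases s) auto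

lemma adj_word_adj_word [simp]: "adj_word (adj_word w) = w"
  by (cases w) (simp add: rev_map comp_def)

lemma inj_adj_word: "inj adj_word"
  by (metis adj_word_adj_word injI)

definition free_star :: "'i free_star_alg \<Rightarrow> 'i free_star_alg" where
  "free_star x = Poly_Mapping.map_key adj_word (Poly_Mapping.map cnj x)"

lemma lookup_free_star:
  "Poly_Mapping.lookup (free_star x) w = cnj (Poly_Mapping.lookup x (adj_word w))"
  by (simp add: free_star_def map_key.rep_eq[OF inj_adj_word] Poly_Mapping.map.rep_eq when_def)

definition free_scale :: "complex \<Rightarrow> 'i free_star_alg \<Rightarrow> 'i free_star_alg" where
  "free_scale c x = Poly_Mapping.single 0 c * x"

definition free_gen :: "'i \<Rightarrow> 'i free_star_alg" where
  "free_gen i = Poly_Mapping.single (Word [Gen i]) 1"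


section \<open>The Cuntz-Krieger algebra\<close>

text \<open>
  The universal $C^*$-algebra on generators and relations is constructed in the standard way:
  the free *-algebra carries the largest $C^*$-seminorm that annihilates the relations, and
  $\mathcal O_A$ is its Hausdorff completion.  (A $C^*$-seminorm annihilating the relations is
  the same thing as $x \mapsto \|\pi(x)\|$ for a *-homomorphism \<open>\<pi>\<close> into some $C^*$-algebra
  sending the \<open>free_gen i\<close> to partial isometries that satisfy the Cuntz-Krieger relations, so
  this avoids quantifying over all $C^*$-algebras.)  The index set of the matrix is
  the finite type \<open>'i\<close>.
\<close>

definition cstar_seminorm :: "('i free_star_alg \<Rightarrow> real) \<Rightarrow> bool" where
  "cstar_seminorm p \<longleftrightarrow>
     (\<forall>x. 0 \<le> p x) \<and>
     (\<forall>x y. p (x + y) \<le> p x + p y) \<and>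
     (\<forall>c x. p (free_scale c x) = cmod c * p x) \<and>
     (\<forall>x y. p (x * y) \<le> p x * p y) \<and>
     (\<forall>x. p (free_star x * x) = (p x)\<^sup>2)"

definition ck_seminorm ::
  "('i::finite \<Rightarrow> 'i \<Rightarrow> nat) \<Rightarrow> ('i free_star_alg \<Rightarrow> real) \<Rightarrow> bool" where
  "ck_seminorm A p \<longleftrightarrow>
     cstar_seminorm p \<and>
     (\<forall>i. p (free_gen i * free_star (free_gen i) * free_gen i - free_gen i) = 0) \<and>
     p ((\<Sum>j\<in>UNIV. free_gen j * free_star (free_gen j)) - 1) = 0 \<and>
     (\<forall>i. p (free_star (free_gen i) * free_gen i -
             (\<Sum>j\<in>UNIV. of_nat (A i j) * (free_gen j * free_star (free_gen j)))) = 0)"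

definition ck_norm :: "('i::finite \<Rightarrow> 'i \<Rightarrow> nat) \<Rightarrow> 'i free_star_alg \<Rightarrow> real" where
  "ck_norm A x = (SUP p\<in>{p. ck_seminorm A p}. p x)"

definition ck_cauchy :: "('i::finite \<Rightarrow> 'i \<Rightarrow> nat) \<Rightarrow> (nat \<Rightarrow> 'i free_star_alg) set" where
  "ck_cauchy A = {X. \<forall>e>0. \<exists>N. \<forall>m\<ge>N. \<forall>n\<ge>N. ck_norm A (X m - X n) < e}"

definition ck_rel :: "('i::finite \<Rightarrow> 'i \<Rightarrow> nat) \<Rightarrow>
    ((nat \<Rightarrow> 'i free_star_alg) \<times> (nat \<Rightarrow> 'i free_star_alg)) set" where
  "ck_rel A = {(X, Y). X \<in> ck_cauchy A \<and> Y \<in> ck_cauchy A \<and>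
                       (\<lambda>n. ck_norm A (X n - Y n)) \<longlonglongrightarrow> 0}"

record 'a cstar_alg = "'a ring" +
  scale :: "complex \<Rightarrow> 'a \<Rightarrow> 'a"
  star :: "'a \<Rightarrow> 'a"
  cnorm :: "'a \<Rightarrow> real"

text \<open>Operations on the completion are induced by the pointwise ones on Cauchy sequences.\<close>

definition cuntz_krieger_alg ::
  "('i::finite \<Rightarrow> 'i \<Rightarrow> nat) \<Rightarrow> (nat \<Rightarrow> 'i free_star_alg) set cstar_alg" where
  "cuntz_krieger_alg A =
     \<lparr>carrier = ck_cauchy A // ck_rel A,
      mult = (\<lambda>a b. \<Union>X\<in>a. \<Union>Y\<in>b. ck_rel A `` {\<lambda>n. X n * Y n}),
      one = ck_rel A `` {\<lambda>n. 1},
      zero = ck_rel A `` {\<lambda>n. 0},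
      add = (\<lambda>a b. \<Union>X\<in>a. \<Union>Y\<in>b. ck_rel A `` {\<lambda>n. X n + Y n}),
      scale = (\<lambda>c a. \<Union>X\<in>a. ck_rel A `` {\<lambda>n. free_scale c (X n)}),
      star = (\<lambda>a. \<Union>X\<in>a. ck_rel A `` {\<lambda>n. free_star (X n)}),
      cnorm = (\<lambda>a. THE r. \<exists>X\<in>a. (\<lambda>n. ck_norm A (X n)) \<longlonglongrightarrow> r)\<rparr>"

definition ck_gen :: "('i::finite \<Rightarrow> 'i \<Rightarrow> nat) \<Rightarrow> 'i \<Rightarrow> (nat \<Rightarrow> 'i free_star_alg) set" where
  "ck_gen A i = ck_rel A `` {\<lambda>n. free_gen i}"


section \<open>Markov-Dyck shifts\<close>

datatype 'i dyck_letter = Alpha 'i | Beta 'i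

fun ck_letter ::
  "('i::finite \<Rightarrow> 'i \<Rightarrow> nat) \<Rightarrow> 'i dyck_letter \<Rightarrow> (nat \<Rightarrow> 'i free_star_alg) set" where
  "ck_letter A (Alpha i) = star (cuntz_krieger_alg A) (ck_gen A i)"
| "ck_letter A (Beta i) = ck_gen A i"

definition forbidden :: "('i::finite \<Rightarrow> 'i \<Rightarrow> nat) \<Rightarrow> 'i dyck_letter list \<Rightarrow> bool" where
  "forbidden A w \<longleftrightarrow>
     foldr (\<lambda>s a. ck_letter A s \<otimes>\<^bsub>cuntz_krieger_alg A\<^esub> a) w \<one>\<^bsub>cuntz_krieger_alg A\<^esub>
       = \<zero>\<^bsub>cuntz_krieger_alg A\<^esub>"

definition markov_dyck_shift :: "('i::finite \<Rightarrow> 'i \<Rightarrow> nat) \<Rightarrow> (int \<Rightarrow> 'i dyck_letter) set" where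
  "markov_dyck_shift A =
     {x. \<forall>k n. \<not> forbidden A (map (\<lambda>m. x (k + int m)) [0..<n])}"


section \<open>Topological conjugacy of subshifts\<close>

definition full_shift_topology :: "(int \<Rightarrow> 'a) topology" where
  "full_shift_topology = product_topology (\<lambda>_. discrete_topology UNIV) UNIV"

definition shift :: "(int \<Rightarrow> 'a) \<Rightarrow> int \<Rightarrow> 'a" where
  "shift x = (\<lambda>k. x (k + 1))"

definition topologically_conjugate :: "(int \<Rightarrow> 'a) set \<Rightarrow> (int \<Rightarrow> 'b) set \<Rightarrow> bool" where
  "topologically_conjugate X Y \<longleftrightarrow>
     (\<exists>h. homeomorphic_map (subtopology full_shift_topology X)
                           (subtopology full_shift_topology Y) h \<and>
          (\<forall>x\<in>X. h (shift x) = shift (h x)))"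


section \<open>Vertex and edge matrices of a graph\<close>

text \<open>The types \<open>'v\<close> and \<open>'e\<close> are meant to be exactly the vertices and edges of \<open>G\<close>.\<close>

definition vertex_matrix :: "('v, 'e) pre_digraph \<Rightarrow> 'v \<Rightarrow> 'v \<Rightarrow> nat" where
  "vertex_matrix G i j = card {e \<in> arcs G. tail G e = i \<and> head G e = j}"

definition edge_matrix :: "('v, 'e) pre_digraph \<Rightarrow> 'e \<Rightarrow> 'e \<Rightarrow> nat" where
  "edge_matrix G e f = (if head G e = tail G f then 1 else 0)"

definition vertex_shift :: "('v::finite, 'e) pre_digraph \<Rightarrow> (int \<Rightarrow> 'v dyck_letter) set" where
  "vertex_shift G = markov_dyck_shift (vertex_matrix G)"

definition edge_shift :: "('v, 'e::finite) pre_digraph \<Rightarrow> (int \<Rightarrow> 'e dyck_letter) set" where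
  "edge_shift G = markov_dyck_shift (edge_matrix G)"


section \<open>The graph \<open>G2\<close>\<close>

datatype G2_vertex = V1 | V2

datatype G2_edge = E11 | E12 | E21

lemma UNIV_G2_vertex: "UNIV = {V1, V2}"
  using G2_vertex.exhaust by blast

lemma UNIV_G2_edge: "UNIV = {E11, E12, E21}"
  using G2_edge.exhaust by blast

instance G2_vertex :: finite
  by standard (simp add: UNIV_G2_vertex)

instance G2_edge :: finite
  by standard (simp add: UNIV_G2_edge)

definition G2 :: "(G2_vertex, G2_edge) pre_digraph" where
  "G2 = \<lparr>verts = {V1, V2}, arcs = {E11, E12, E21},
         tail = (\<lambda>e. case e of E11 \<Rightarrow> V1 | E12 \<Rightarrow> V1 | E21 \<Rightarrow> V2),
         head = (\<lambda>e. case e of E11 \<Rightarrow> V1 | E12 \<Rightarrow> V2 | E21 \<Rightarrow> V1)\<rparr>"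

lemma fin_digraph_G2: "fin_digraph G2"
  by unfold_locales (auto simp: G2_def split: G2_edge.splits)

lemma vertex_matrix_G2:
  "vertex_matrix G2 V1 V1 = 1" "vertex_matrix G2 V1 V2 = 1"
  "vertex_matrix G2 V2 V1 = 1" "vertex_matrix G2 V2 V2 = 0"
proof -
  have "{e \<in> arcs G2. tail G2 e = V1 \<and> head G2 e = V1} = {E11}"
    "{e \<in> arcs G2. tail G2 e = V1 \<and> head G2 e = V2} = {E12}"
    "{e \<in> arcs G2. tail G2 e = V2 \<and> head G2 e = V1} = {E21}"
    "{e \<in> arcs G2. tail G2 e = V2 \<and> head G2 e = V2} = {}"
    by (auto simp: G2_def intro: G2_edge.exhaust split: G2_edge.splits)
  then show "vertex_matrix G2 V1 V1 = 1" "vertex_matrix G2 V1 V2 = 1"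
    "vertex_matrix G2 V2 V1 = 1" "vertex_matrix G2 V2 V2 = 0"
    by (simp_all add: vertex_matrix_def)
qed

lemma edge_matrix_G2:
  "edge_matrix G2 E11 E11 = 1" "edge_matrix G2 E11 E12 = 1" "edge_matrix G2 E11 E21 = 0"
  "edge_matrix G2 E12 E11 = 0" "edge_matrix G2 E12 E12 = 0" "edge_matrix G2 E12 E21 = 1"
  "edge_matrix G2 E21 E11 = 1" "edge_matrix G2 E21 E12 = 1" "edge_matrix G2 E21 E21 = 0"
  by (simp_all add: edge_matrix_def G2_def)

end

theory Submission
  imports Defs
begin

text \<open>
  A conjugacy restricts to a bijection between the sets of points fixed by the second power of the
  shift, and these sets have different cardinalities. A point of this kind alternates between two
  letters $a$ and $b$. For a $\{0,1\}$-matrix $A$ without zero rows it lies in $D_A$ in exactly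
  two situations: either $a, b$ are both \<open>Alpha\<close>s or both \<open>Beta\<close>s and
  their indices form a closed walk of length two for $A$, or $a, b$ are \<open>Alpha i\<close> and
  \<open>Beta i\<close>, in either order, for one index $i$. So there are $2
  \operatorname{tr}(A^2) + 2M$ of them. The vertex and the edge matrix of a graph have equally
  many closed walks of each positive length, but their sizes differ: for \<open>G2\<close> both
  matrices have three closed walks of length two, whereas $M$ is $2$ for vertices and $3$ for
  edges, and the counts are $10$ and $12$.

  It is enough to bound the first count from above and the second one from below.  The seminorm
  \<open>ck_norm A\<close> is itself a $C^*$-seminorm satisfying the Cuntz-Krieger relations
  (\<open>ck_seminorm_ck_norm\<close>), so a word is forbidden if and only if every such seminorm
  kills the corresponding monomial (\<open>forbidden_iff_ck_seminorms\<close>).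

  For the upper bound, the relations must force certain words of length two to vanish
  (\<open>forbidden_two_letters\<close>).  With two generators this is pure algebra: if two
  projections add up to $1$, then their product is $0$.

  For the lower bound, words must be shown not to vanish, which needs a representation.  The
  generators act on the space of one-sided infinite paths of $A$ by partial bijections, $t_i$
  prefixing a path with $i$ and $t_i^*$ deleting an initial $i$.  On finitely supported functions on
  paths this gives a *-representation whose operator norm is a Cuntz-Krieger seminorm
  (\<open>ck_seminorm_path_norm\<close>).  A bi-infinite orbit of paths driven by a sequence of
  letters shows that no window of that sequence vanishes (\<open>markov_dyck_shift_if_orbit\<close>).
\<close>

section \<open>The involution of the free *-algebra\<close>

lemma free_star_add: "free_star (x + y) = free_star x + free_star y"
  by (rule poly_mapping_eqI) (simp add: lookup_free_star lookup_add)

lemma free_star_diff: "free_star (x - y) = free_star x - free_star y"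
  by (rule poly_mapping_eqI) (simp add: lookup_free_star lookup_minus)

lemma free_star_free_star [simp]: "free_star (free_star x) = x"
  by (rule poly_mapping_eqI) (simp add: lookup_free_star)

lemma adj_word_eq_iff: "adj_word v = w \<longleftrightarrow> v = adj_word w"
  by (metis adj_word_adj_word)

lemma free_star_single:
  "free_star (Poly_Mapping.single w c) = Poly_Mapping.single (adj_word w) (cnj c)"
  by (rule poly_mapping_eqI) (auto simp: lookup_free_star lookup_single when_def adj_word_eq_iff)

lemma adj_word_plus: "adj_word (u + v) = adj_word v + adj_word u"
  by (cases u; cases v) simp

lemma poly_mapping_eq_sum_single:
  fixes x :: "'a \<Rightarrow>\<^sub>0 'b::comm_monoid_add"
  shows "x = (\<Sum>w\<in>Poly_Mapping.keys x. Poly_Mapping.single w (Poly_Mapping.lookup x w))"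
proof (rule poly_mapping_eqI)
  fix v
  show "Poly_Mapping.lookup x v =
    Poly_Mapping.lookup (\<Sum>w\<in>Poly_Mapping.keys x. Poly_Mapping.single w (Poly_Mapping.lookup x w)) v"
    by (cases "v \<in> Poly_Mapping.keys x")
       (auto simp: lookup_sum lookup_single when_def in_keys_iff)
qed

lemma poly_mapping_induct_single [case_names single add]:
  fixes x :: "'a \<Rightarrow>\<^sub>0 'b::comm_monoid_add"
  assumes single: "\<And>w c. P (Poly_Mapping.single w c)"
    and add: "\<And>x y. P x \<Longrightarrow> P y \<Longrightarrow> P (x + y)"
  shows "P x"
proof -
  have "P (\<Sum>w\<in>K. Poly_Mapping.single w (Poly_Mapping.lookup x w))" if "finite K" for K
    using that
  proof (induction K)
    case empty
    then show ?case using single[of undefined 0] by simp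
  next
    case (insert w K)
    then show ?case by (simp add: single add)
  qed
  then show ?thesis
    by (subst poly_mapping_eq_sum_single) simp
qed

lemma free_star_mult: "free_star (x * y) = free_star y * free_star x"
proof (induction x rule: poly_mapping_induct_single)
  case (single v c)
  show ?case
    by (induction y rule: poly_mapping_induct_single)
       (simp_all add: mult_single free_star_single adj_word_plus mult.commute
          distrib_left distrib_right free_star_add)
qed (simp add: distrib_left distrib_right free_star_add)

lemma free_star_one [simp]: "free_star 1 = 1"
  by (simp add: free_star_single zero_star_word_def flip: single_one)


section \<open>$C^*$-seminorms and their null ideals\<close>

context
  fixes p :: "'i free_star_alg \<Rightarrow> real"
  assumes p: "cstar_seminorm p"
begin

lemma cstar_seminorm_nonneg: "0 \<le> p x"
  and cstar_seminorm_triangle: "p (x + y) \<le> p x + p y"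
  and cstar_seminorm_scale: "p (free_scale c x) = cmod c * p x"
  and cstar_seminorm_mult: "p (x * y) \<le> p x * p y"
  and cstar_seminorm_identity: "p (free_star x * x) = (p x)\<^sup>2"
  using p by (auto simp: cstar_seminorm_def)

lemma cstar_seminorm_zero: "p 0 = 0"
  using cstar_seminorm_scale[of 0 0] by (simp add: free_scale_def)

lemma cstar_seminorm_uminus: "p (- x) = p x"
  using cstar_seminorm_scale[of "-1" x] by (simp add: free_scale_def single_uminus)

lemma cstar_seminorm_minus_commute: "p (x - y) = p (y - x)"
  using cstar_seminorm_uminus[of "x - y"] by simp

text \<open>
  The $C^*$-identity gives $p(x)^2 = p(x^* x) \le p(x^*)\,p(x)$, hence $p(x) \le p(x^*)$.
\<close>

lemma cstar_seminorm_star: "p (free_star x) = p x"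
proof -
  have le: "p y \<le> p (free_star y)" for y
  proof (cases "p y = 0")
    case True
    then show ?thesis by (simp add: cstar_seminorm_nonneg)
  next
    case False
    have "p y * p y \<le> p (free_star y) * p y"
      using cstar_seminorm_mult[of "free_star y" y]
      by (simp add: cstar_seminorm_identity power2_eq_square)
    then show ?thesis
      using False cstar_seminorm_nonneg[of y] by simp
  qed
  from le[of x] le[of "free_star x"] show ?thesis by simp
qed

lemma cstar_null_mult_left: "p x = 0 \<Longrightarrow> p (y * x) = 0"
  using cstar_seminorm_mult[of y x] cstar_seminorm_nonneg[of "y * x"] by simp

lemma cstar_null_mult_right: "p x = 0 \<Longrightarrow> p (x * y) = 0"
  using cstar_seminorm_mult[of x y] cstar_seminorm_nonneg[of "x * y"] by simp

lemma cstar_null_add: "p x = 0 \<Longrightarrow> p y = 0 \<Longrightarrow> p (x + y) = 0"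
  using cstar_seminorm_triangle[of x y] cstar_seminorm_nonneg[of "x + y"] by simp

lemma cstar_null_diff: "p x = 0 \<Longrightarrow> p y = 0 \<Longrightarrow> p (x - y) = 0"
  using cstar_null_add[of x "- y"] by (simp add: cstar_seminorm_uminus)

lemma cstar_null_sum: "(\<And>i. i \<in> I \<Longrightarrow> p (F i) = 0) \<Longrightarrow> p (\<Sum>i\<in>I. F i) = 0"
  by (induction I rule: infinite_finite_induct) (simp_all add: cstar_seminorm_zero cstar_null_add)

lemma cstar_null_diff_eq: assumes "p (x - y) = 0" shows "p x = p y"
  using cstar_seminorm_triangle[of "x - y" y] cstar_seminorm_triangle[of "y - x" x]
    cstar_seminorm_minus_commute[of x y] assms
  by simp

lemmas cstar_null_intros =
  cstar_null_add cstar_null_diff cstar_null_mult_left cstar_null_mult_right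

end


section \<open>The universal Cuntz-Krieger seminorm\<close>

lemma ck_seminormD:
  assumes "ck_seminorm A p"
  shows "cstar_seminorm p"
    and "p (free_gen i * free_star (free_gen i) * free_gen i - free_gen i) = 0"
    and "p ((\<Sum>j\<in>UNIV. free_gen j * free_star (free_gen j)) - 1) = 0"
    and "p (free_star (free_gen i) * free_gen i -
             (\<Sum>j\<in>UNIV. of_nat (A i j) * (free_gen j * free_star (free_gen j)))) = 0"
  using assms by (auto simp: ck_seminorm_def)

text \<open>
  The element $e = t_i^* t_i$ is a projection modulo the null ideal, so $p(e)^2 = p(e)$ and
  $p(e)$ is $0$ or $1$.  Together with $p(t_i)^2 = p(e)$ this bounds the generators uniformly
  in $p$, which is what makes the supremum in \<open>ck_norm\<close> finite.
\<close>

lemma ck_seminorm_gen_le: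
  assumes A: "ck_seminorm A p"
  shows "p (free_gen i) \<le> 1"
proof -
  note p = ck_seminormD(1)[OF A]
  let ?t = "free_gen i"
  let ?e = "free_star ?t * ?t"
  have "?e * ?e - ?e = free_star ?t * (?t * free_star ?t * ?t - ?t)"
    by (simp add: algebra_simps)
  then have "p (?e * ?e - ?e) = 0"
    by (simp add: cstar_null_mult_left[OF p] ck_seminormD(2)[OF A])
  moreover have "free_star ?e = ?e"
    by (simp add: free_star_mult)
  ultimately have "(p ?e)\<^sup>2 = p ?e"
    using cstar_seminorm_identity[OF p, of ?e] cstar_null_diff_eq[OF p] by metis
  then have "p ?e \<le> 1"
    by (auto simp: power2_eq_square)
  then show ?thesis
    using cstar_seminorm_identity[OF p, of ?t] cstar_seminorm_nonneg[OF p, of ?t]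
    by (simp add: power_le_one_iff)
qed

lemma ck_seminorm_word_le:
  assumes A: "ck_seminorm A p"
  shows "p (Poly_Mapping.single (Word u) 1) \<le> 1"
proof (induction u)
  note p = ck_seminormD(1)[OF A]
  case Nil
  have "(p 1)\<^sup>2 = p 1"
    using cstar_seminorm_identity[OF p, of 1] by simp
  then have "p 1 \<le> 1" by (auto simp: power2_eq_square)
  moreover have "Poly_Mapping.single (Word []) 1 = 1"
    by (simp flip: single_one zero_star_word_def)
  ultimately show ?case by metis
next
  note p = ck_seminormD(1)[OF A]
  case (Cons s u)
  have "p (Poly_Mapping.single (Word [s]) 1) \<le> 1"
  proof (cases s)
    case (Gen i)
    then show ?thesis using ck_seminorm_gen_le[OF A, of i] by (simp add: free_gen_def)
  next
    case (Adj i)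
    then have "Poly_Mapping.single (Word [s]) 1 = free_star (free_gen i)"
      by (simp add: free_gen_def free_star_single)
    then show ?thesis
      using ck_seminorm_gen_le[OF A, of i] cstar_seminorm_star[OF p] by metis
  qed
  moreover have "Poly_Mapping.single (Word (s # u)) (1::complex) =
      Poly_Mapping.single (Word [s]) 1 * Poly_Mapping.single (Word u) 1"
    by (simp add: mult_single)
  ultimately show ?case
    using cstar_seminorm_mult[OF p] Cons.IH cstar_seminorm_nonneg[OF p]
    by (smt (verit, best) mult_le_one)
qed

lemma ck_seminorm_bound:
  assumes A: "ck_seminorm A p"
  shows "p x \<le> (\<Sum>w\<in>Poly_Mapping.keys x. cmod (Poly_Mapping.lookup x w))"
proof -
  note p = ck_seminormD(1)[OF A]
  have single: "p (Poly_Mapping.single w c) \<le> cmod c" for w c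
  proof -
    have "Poly_Mapping.single w c = free_scale c (Poly_Mapping.single w 1)"
      by (simp add: free_scale_def mult_single)
    then show ?thesis
      using ck_seminorm_word_le[OF A] cstar_seminorm_scale[OF p]
      by (cases w) (simp add: mult_left_le)
  qed
  have "p (\<Sum>w\<in>K. Poly_Mapping.single w (Poly_Mapping.lookup x w))
      \<le> (\<Sum>w\<in>K. cmod (Poly_Mapping.lookup x w))" if "finite K" for K
    using that
  proof (induction K)
    case (insert w K)
    then show ?case
      using single[of w "Poly_Mapping.lookup x w"]
      by (simp) (smt (verit) cstar_seminorm_triangle[OF p])
  qed (simp add: cstar_seminorm_zero[OF p])
  then show ?thesis
    using poly_mapping_eq_sum_single[of x] by (metis finite_keys)
qed

lemma ck_seminorm_zero: "ck_seminorm A (\<lambda>_. 0)"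
  by (simp add: ck_seminorm_def cstar_seminorm_def)

lemma ck_seminorm_le_ck_norm:
  assumes "ck_seminorm A p"
  shows "p x \<le> ck_norm A x"
  unfolding ck_norm_def using assms
  by (auto intro!: cSUP_upper bdd_aboveI2 ck_seminorm_bound)

lemma ck_norm_le:
  assumes "\<And>p. ck_seminorm A p \<Longrightarrow> p x \<le> c"
  shows "ck_norm A x \<le> c"
  unfolding ck_norm_def using assms ck_seminorm_zero by (auto intro!: cSUP_least)

lemma ck_norm_nonneg: "0 \<le> ck_norm A x"
  using ck_seminorm_le_ck_norm[OF ck_seminorm_zero] .

lemma ck_norm_eq_0_iff: "ck_norm A x = 0 \<longleftrightarrow> (\<forall>p. ck_seminorm A p \<longrightarrow> p x = 0)"
proof
  assume "ck_norm A x = 0"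
  then show "\<forall>p. ck_seminorm A p \<longrightarrow> p x = 0"
    using ck_seminorm_le_ck_norm[of A _ x] ck_seminormD(1)[THEN cstar_seminorm_nonneg]
    by (metis order_antisym)
next
  assume "\<forall>p. ck_seminorm A p \<longrightarrow> p x = 0"
  then show "ck_norm A x = 0"
    by (intro order_antisym ck_norm_nonneg ck_norm_le) (metis order_refl)
qed

text \<open>
  All the defining conditions survive a pointwise supremum; the $C^*$-identity does because
  squaring is monotone on nonnegative reals.
\<close>

lemma ck_seminorm_ck_norm: "ck_seminorm A (ck_norm A)"
proof -
  let ?N = "ck_norm A"
  have "cstar_seminorm ?N"
    unfolding cstar_seminorm_def
  proof (intro conjI allI)
    fix x y and c :: complex
    show "0 \<le> ?N x" by (rule ck_norm_nonneg)
    show "?N (x + y) \<le> ?N x + ?N y"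
    proof (rule ck_norm_le)
      fix p assume A: "ck_seminorm A p"
      note cstar_seminorm_triangle[OF ck_seminormD(1)[OF A], of x y]
      also have "p x + p y \<le> ?N x + ?N y"
        by (intro add_mono ck_seminorm_le_ck_norm A)
      finally show "p (x + y) \<le> ?N x + ?N y" .
    qed
    show "?N (x * y) \<le> ?N x * ?N y"
    proof (rule ck_norm_le)
      fix p assume A: "ck_seminorm A p"
      note cstar_seminorm_mult[OF ck_seminormD(1)[OF A], of x y]
      also have "p x * p y \<le> ?N x * ?N y"
        by (intro mult_mono ck_seminorm_le_ck_norm A ck_norm_nonneg
            cstar_seminorm_nonneg[OF ck_seminormD(1)[OF A]])
      finally show "p (x * y) \<le> ?N x * ?N y" .
    qed
    show "?N (free_scale c x) = cmod c * ?N x"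
    proof (rule antisym)
      show "?N (free_scale c x) \<le> cmod c * ?N x"
        by (rule ck_norm_le)
           (simp add: cstar_seminorm_scale[OF ck_seminormD(1)] mult_left_mono ck_seminorm_le_ck_norm)
      show "cmod c * ?N x \<le> ?N (free_scale c x)"
      proof (cases "c = 0")
        case True
        then show ?thesis by (simp add: ck_norm_nonneg)
      next
        case False
        have "?N x \<le> ?N (free_scale c x) / cmod c"
        proof (rule ck_norm_le)
          fix p assume A: "ck_seminorm A p"
          show "p x \<le> ?N (free_scale c x) / cmod c"
            using ck_seminorm_le_ck_norm[OF A, of "free_scale c x"] False
            by (simp add: cstar_seminorm_scale[OF ck_seminormD(1)[OF A]] field_simps)
        qed
        then show ?thesis using False by (simp add: field_simps)
      qed
    qed
    show "?N (free_star x * x) = (?N x)\<^sup>2"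
    proof (rule antisym)
      show "?N (free_star x * x) \<le> (?N x)\<^sup>2"
      proof (rule ck_norm_le)
        fix p assume A: "ck_seminorm A p"
        show "p (free_star x * x) \<le> (?N x)\<^sup>2"
          using ck_seminorm_le_ck_norm[OF A, of x] cstar_seminorm_nonneg[OF ck_seminormD(1)[OF A]]
          by (simp add: cstar_seminorm_identity[OF ck_seminormD(1)[OF A]] power_mono)
      qed
      have "?N x \<le> sqrt (?N (free_star x * x))"
      proof (rule ck_norm_le)
        fix p assume A: "ck_seminorm A p"
        show "p x \<le> sqrt (?N (free_star x * x))"
          using ck_seminorm_le_ck_norm[OF A, of "free_star x * x"]
          by (simp add: cstar_seminorm_identity[OF ck_seminormD(1)[OF A]] real_le_rsqrt)
      qed
      then have "(?N x)\<^sup>2 \<le> (sqrt (?N (free_star x * x)))\<^sup>2"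
        by (rule power_mono) (rule ck_norm_nonneg)
      then show "(?N x)\<^sup>2 \<le> ?N (free_star x * x)"
        by (simp add: ck_norm_nonneg)
    qed
  qed
  then show ?thesis
    unfolding ck_seminorm_def by (auto simp: ck_norm_eq_0_iff ck_seminorm_def)
qed

lemmas cstar_seminorm_ck_norm = ck_seminormD(1)[OF ck_seminorm_ck_norm]

text \<open>
  Sandwiching $t_i t_i^* + t_j t_j^* = 1$ between $t_i^*$ and $t_j$ gives
  $t_i^* t_j + t_i^* t_j = t_i^* t_j$, because $t_i^*$ and $t_j$ are partial isometries.
\<close>

lemma ck_orthogonal_ranges:
  assumes A: "ck_seminorm A p" and ij: "UNIV = {i, j}" "i \<noteq> j"
  shows "p (free_star (free_gen i) * free_gen j) = 0"
proof -
  note p = ck_seminormD(1)[OF A]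
  let ?ti = "free_gen i" and ?tj = "free_gen j"
  let ?si = "free_star ?ti" and ?sj = "free_star ?tj"
  have 1: "p (?ti * ?si + ?tj * ?sj - 1) = 0"
    using ck_seminormD(3)[OF A, unfolded ij(1)] ij(2) by simp
  have "?si * ?ti * ?si - ?si = free_star (?ti * ?si * ?ti - ?ti)"
    by (simp add: free_star_diff free_star_mult mult.assoc)
  then have 2: "p (?si * ?ti * ?si - ?si) = 0"
    by (simp add: cstar_seminorm_star[OF p] ck_seminormD(2)[OF A])
  have "?si * ?tj = ?si * (?ti * ?si + ?tj * ?sj - 1) * ?tj
      - (?si * ?ti * ?si - ?si) * ?tj - ?si * (?tj * ?sj * ?tj - ?tj)"
    by (simp add: algebra_simps)
  also have "p \<dots> = 0"
    by (intro cstar_null_intros[OF p] 1 2 ck_seminormD(2)[OF A])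
  finally show ?thesis .
qed

text \<open>
  In $t_i t_j = t_i (t_i^* t_i) t_j = \sum_k A(i,k)\, t_i t_k t_k^* t_j$ the terms with $k \neq j$
  vanish by orthogonality of ranges and the term $k = j$ by its coefficient.
\<close>

lemma ck_gen_product_null:
  assumes A: "ck_seminorm A p"
    and orth: "\<And>k. k \<noteq> j \<Longrightarrow> p (free_star (free_gen k) * free_gen j) = 0"
    and "A i j = 0"
  shows "p (free_gen i * free_gen j) = 0"
proof -
  note p = ck_seminormD(1)[OF A]
  let ?t = "free_gen i" and ?u = "free_gen j"
  let ?s = "free_star ?t"
  let ?Q = "\<Sum>k\<in>UNIV. of_nat (A i k) * (free_gen k * free_star (free_gen k))"
  have "p (of_nat (A i k) * free_gen k * (free_star (free_gen k) * ?u)) = 0" for k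
    using assms(3) by (cases "k = j") (simp_all add: cstar_seminorm_zero[OF p] cstar_null_intros[OF p] orth)
  then have "p (\<Sum>k\<in>UNIV. of_nat (A i k) * free_gen k * (free_star (free_gen k) * ?u)) = 0"
    by (intro cstar_null_sum[OF p])
  then have Q: "p (?Q * ?u) = 0"
    by (simp add: sum_distrib_right mult.assoc)
  have "?t * ?u = ?t * (?s * ?t - ?Q) * ?u + ?t * (?Q * ?u) - (?t * ?s * ?t - ?t) * ?u"
    by (simp add: right_diff_distrib left_diff_distrib mult.assoc)
  also have "p \<dots> = 0"
    by (intro cstar_null_intros[OF p] Q ck_seminormD[OF A])
  finally show ?thesis .
qed


section \<open>Forbidden words as null monomials\<close>

text \<open>The image in the completion \<open>cuntz_krieger_alg A\<close> of an element of the free algebra.\<close>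

definition ck_class ::
  "('i::finite \<Rightarrow> 'i \<Rightarrow> nat) \<Rightarrow> 'i free_star_alg \<Rightarrow> (nat \<Rightarrow> 'i free_star_alg) set" where
  "ck_class A x = ck_rel A `` {\<lambda>_. x}"

lemma ck_cauchyI:
  assumes "(\<lambda>n. ck_norm A (x - X n)) \<longlonglongrightarrow> 0"
  shows "X \<in> ck_cauchy A"
  unfolding ck_cauchy_def mem_Collect_eq
proof (intro allI impI)
  note N = cstar_seminorm_ck_norm[of A]
  fix e :: real assume "e > 0"
  then obtain N where N': "\<And>n. n \<ge> N \<Longrightarrow> ck_norm A (x - X n) < e / 2"
    using LIMSEQ_D[OF assms, of "e / 2"] by (auto simp: ck_norm_nonneg)
  have "ck_norm A (X m - X n) < e" if "m \<ge> N" "n \<ge> N" for m n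
    using cstar_seminorm_triangle[OF N, of "X m - x" "x - X n"] N'[OF that(1)] N'[OF that(2)]
    by (simp add: cstar_seminorm_minus_commute[OF N, of "X m"])
  then show "\<exists>N. \<forall>m\<ge>N. \<forall>n\<ge>N. ck_norm A (X m - X n) < e" by blast
qed

lemma const_in_ck_cauchy [simp]: "(\<lambda>_. x) \<in> ck_cauchy A"
  by (rule ck_cauchyI[of _ x]) (simp add: cstar_seminorm_zero[OF cstar_seminorm_ck_norm])

lemma equiv_ck_rel: "equiv (ck_cauchy A) (ck_rel A)"
proof (rule equivI)
  note N = cstar_seminorm_ck_norm[of A]
  show "ck_rel A \<subseteq> ck_cauchy A \<times> ck_cauchy A"
    by (auto simp: ck_rel_def)
  show "refl_on (ck_cauchy A) (ck_rel A)"
    by (auto simp: refl_on_def ck_rel_def cstar_seminorm_zero[OF N])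
  show "sym (ck_rel A)"
    unfolding sym_def ck_rel_def
    using cstar_seminorm_minus_commute[OF N] by auto
  show "trans (ck_rel A)"
    unfolding trans_def ck_rel_def
  proof (clarsimp)
    fix X Y Z
    assume XY: "(\<lambda>n. ck_norm A (X n - Y n)) \<longlonglongrightarrow> 0" and YZ: "(\<lambda>n. ck_norm A (Y n - Z n)) \<longlonglongrightarrow> 0"
    show "(\<lambda>n. ck_norm A (X n - Z n)) \<longlonglongrightarrow> 0"
    proof (rule tendsto_sandwich[OF _ _ tendsto_const])
      show "(\<lambda>n. ck_norm A (X n - Y n) + ck_norm A (Y n - Z n)) \<longlonglongrightarrow> 0"
        using tendsto_add[OF XY YZ] by simp
      show "\<forall>\<^sub>F n in sequentially. ck_norm A (X n - Z n) \<le> ck_norm A (X n - Y n) + ck_norm A (Y n - Z n)"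
        using cstar_seminorm_triangle[OF N, of "X n - Y n" "Y n - Z n" for n] by simp
    qed (simp add: ck_norm_nonneg)
  qed
qed

lemma mem_ck_class_iff: "X \<in> ck_class A x \<longleftrightarrow> (\<lambda>n. ck_norm A (x - X n)) \<longlonglongrightarrow> 0"
  using ck_cauchyI[of A x X] by (auto simp: ck_class_def ck_rel_def)

lemma const_mem_ck_class: "(\<lambda>_. x) \<in> ck_class A x"
  by (simp add: mem_ck_class_iff cstar_seminorm_zero[OF cstar_seminorm_ck_norm])

lemma ck_class_eqI: "X \<in> ck_class A x \<Longrightarrow> ck_rel A `` {X} = ck_class A x"
  unfolding ck_class_def using equiv_class_eq[OF equiv_ck_rel[of A]] by blast

lemma ck_class_eq_iff: "ck_class A x = ck_class A y \<longleftrightarrow> ck_norm A (x - y) = 0"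
proof -
  have "ck_class A x = ck_class A y \<longleftrightarrow> (\<lambda>_. y) \<in> ck_class A x"
    using ck_class_eqI[of "\<lambda>_. y" A x] const_mem_ck_class[of y A]
    by (auto simp: ck_class_def[of A y])
  then show ?thesis
    by (simp add: mem_ck_class_iff LIMSEQ_const_iff)
qed

text \<open>
  Multiplication in the completion is a union over all representatives; it takes a single value
  because multiplication is jointly continuous for the seminorm.
\<close>

lemma ck_class_mult:
  "ck_class A x \<otimes>\<^bsub>cuntz_krieger_alg A\<^esub> ck_class A y = ck_class A (x * y)"
proof -
  note N = cstar_seminorm_ck_norm[of A]
  have main: "(\<lambda>n. X n * Y n) \<in> ck_class A (x * y)" if "X \<in> ck_class A x" "Y \<in> ck_class A y" for X Y
    unfolding mem_ck_class_iff
  proof (rule tendsto_sandwich[OF _ _ tendsto_const])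
    let ?d = "\<lambda>n. ck_norm A (x - X n)" and ?e = "\<lambda>n. ck_norm A (y - Y n)"
    have lim: "?d \<longlonglongrightarrow> 0" "?e \<longlonglongrightarrow> 0"
      using that by (simp_all add: mem_ck_class_iff)
    have "(\<lambda>n. ck_norm A x * ?e n + (?d n * ck_norm A y + ?d n * ?e n))
        \<longlonglongrightarrow> ck_norm A x * 0 + (0 * ck_norm A y + 0 * 0)"
      by (intro tendsto_intros lim)
    then show "(\<lambda>n. ck_norm A x * ?e n + (?d n * ck_norm A y + ?d n * ?e n)) \<longlonglongrightarrow> 0"
      by simp
    have "ck_norm A (x * y - X n * Y n) \<le> ck_norm A x * ?e n + (?d n * ck_norm A y + ?d n * ?e n)" for n
    proof -
      have "x * y - X n * Y n
          = x * (y - Y n) + ((x - X n) * y + (- (x - X n)) * (y - Y n))"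
        by (simp add: algebra_simps)
      also have "ck_norm A \<dots> \<le> ck_norm A (x * (y - Y n)) +
          (ck_norm A ((x - X n) * y) + ck_norm A (- (x - X n) * (y - Y n)))"
        using cstar_seminorm_triangle[OF N] by (meson add_left_mono order_trans)
      also have "\<dots> \<le> ck_norm A x * ?e n + (?d n * ck_norm A y + ck_norm A (- (x - X n)) * ?e n)"
        by (intro add_mono cstar_seminorm_mult[OF N])
      finally show ?thesis
        by (simp only: cstar_seminorm_uminus[OF N])
    qed
    then show "\<forall>\<^sub>F n in sequentially. ck_norm A (x * y - X n * Y n)
        \<le> ck_norm A x * ?e n + (?d n * ck_norm A y + ?d n * ?e n)"
      by simp
  qed (simp add: ck_norm_nonneg)
  have eq: "ck_rel A `` {\<lambda>n. X n * Y n} = ck_class A (x * y)"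
    if "X \<in> ck_class A x" "Y \<in> ck_class A y" for X Y
    by (intro ck_class_eqI main that)
  have "ck_class A x \<otimes>\<^bsub>cuntz_krieger_alg A\<^esub> ck_class A y
      = (\<Union>X\<in>ck_class A x. \<Union>Y\<in>ck_class A y. ck_rel A `` {\<lambda>n. X n * Y n})"
    by (simp add: cuntz_krieger_alg_def)
  also have "\<dots> = (\<Union>X\<in>ck_class A x. \<Union>Y\<in>ck_class A y. ck_class A (x * y))"
    by (intro SUP_cong refl eq)
  also have "\<dots> = ck_class A (x * y)"
    using const_mem_ck_class[of x A] const_mem_ck_class[of y A] by blast
  finally show ?thesis .
qed

lemma ck_class_star: "star (cuntz_krieger_alg A) (ck_class A x) = ck_class A (free_star x)"
proof -
  note N = cstar_seminorm_ck_norm[of A]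
  have main: "(\<lambda>n. free_star (X n)) \<in> ck_class A (free_star x)" if "X \<in> ck_class A x" for X
    using that by (simp add: mem_ck_class_iff cstar_seminorm_star[OF N] flip: free_star_diff)
  have eq: "ck_rel A `` {\<lambda>n. free_star (X n)} = ck_class A (free_star x)"
    if "X \<in> ck_class A x" for X
    by (intro ck_class_eqI main that)
  have "star (cuntz_krieger_alg A) (ck_class A x)
      = (\<Union>X\<in>ck_class A x. ck_rel A `` {\<lambda>n. free_star (X n)})"
    by (simp add: cuntz_krieger_alg_def)
  also have "\<dots> = (\<Union>X\<in>ck_class A x. ck_class A (free_star x))"
    by (intro SUP_cong refl eq)
  also have "\<dots> = ck_class A (free_star x)"
    using const_mem_ck_class[of x A] by blast
  finally show ?thesis .
qed

fun letter_symbol :: "'i dyck_letter \<Rightarrow> 'i star_symbol" where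
  "letter_symbol (Alpha i) = Adj i"
| "letter_symbol (Beta i) = Gen i"

definition word_monomial :: "'i star_symbol list \<Rightarrow> 'i free_star_alg" where
  "word_monomial u = Poly_Mapping.single (Word u) 1"

lemma word_monomial_Nil: "word_monomial [] = 1"
  by (simp add: word_monomial_def flip: single_one zero_star_word_def)

lemma word_monomial_append: "word_monomial (u @ v) = word_monomial u * word_monomial v"
  by (simp add: word_monomial_def mult_single)

lemma free_gen_eq: "free_gen i = word_monomial [Gen i]"
  by (simp add: free_gen_def word_monomial_def)

lemma free_star_word_monomial:
  "free_star (word_monomial u) = word_monomial (rev (map adj_symbol u))"
  by (simp add: word_monomial_def free_star_single)

lemma ck_letter_eq: "ck_letter A s = ck_class A (word_monomial [letter_symbol s])"
proof -
  have "ck_gen A i = ck_class A (free_gen i)" for i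
    by (simp add: ck_gen_def ck_class_def)
  then show ?thesis
    by (cases s) (simp_all add: ck_class_star free_gen_eq free_star_word_monomial)
qed

lemma forbidden_iff:
  "forbidden A w \<longleftrightarrow> ck_norm A (word_monomial (map letter_symbol w)) = 0"
proof -
  let ?O = "cuntz_krieger_alg A"
  have "foldr (\<lambda>s a. ck_letter A s \<otimes>\<^bsub>?O\<^esub> a) w \<one>\<^bsub>?O\<^esub> = ck_class A (word_monomial (map letter_symbol w))"
  proof (induction w)
    case Nil
    show ?case
      by (simp add: word_monomial_Nil cuntz_krieger_alg_def ck_class_def)
  next
    case (Cons s w)
    then show ?case
      by (simp add: ck_letter_eq ck_class_mult flip: word_monomial_append)
  qed
  moreover have "\<zero>\<^bsub>?O\<^esub> = ck_class A 0"
    by (simp add: cuntz_krieger_alg_def ck_class_def)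
  ultimately show ?thesis
    by (simp add: forbidden_def ck_class_eq_iff)
qed

lemma forbidden_iff_ck_seminorms:
  "forbidden A w \<longleftrightarrow>
    (\<forall>p. ck_seminorm A p \<longrightarrow> p (word_monomial (map letter_symbol w)) = 0)"
  by (simp add: forbidden_iff ck_norm_eq_0_iff)


section \<open>A pre-Hilbert space of finitely supported functions\<close>

text \<open>
  Complex functions of finite support suffice as a representation space: every operator below
  and its adjoint preserve finite support, and neither operator norms nor the $C^*$-identity
  need completeness.  Only the real part of the usual inner product is used: an adjoint for the
  complex inner product is also one for its real part, and both give the same norm.
\<close>

typedef 'a fin_l2 = "{f :: 'a \<Rightarrow> complex. finite {x. f x \<noteq> 0}}"
  morphisms entry Abs_fin_l2
  by (rule exI[of _ "\<lambda>_. 0"]) simp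

setup_lifting type_definition_fin_l2

lemma finite_support [simp]: "finite {x. entry f x \<noteq> 0}"
  using entry[of f] by simp

lemma fin_l2_eqI: "(\<And>x. entry f x = entry g x) \<Longrightarrow> f = g"
  by (metis entry_inject ext)

instantiation fin_l2 :: (type) real_vector
begin

lift_definition zero_fin_l2 :: "'a fin_l2" is "\<lambda>_. 0" by simp

lift_definition plus_fin_l2 :: "'a fin_l2 \<Rightarrow> 'a fin_l2 \<Rightarrow> 'a fin_l2" is "\<lambda>f g x. f x + g x"
  by (erule (1) rev_finite_subset[OF finite_UnI]) auto

lift_definition minus_fin_l2 :: "'a fin_l2 \<Rightarrow> 'a fin_l2 \<Rightarrow> 'a fin_l2" is "\<lambda>f g x. f x - g x"
  by (erule (1) rev_finite_subset[OF finite_UnI]) auto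

lift_definition uminus_fin_l2 :: "'a fin_l2 \<Rightarrow> 'a fin_l2" is "\<lambda>f x. - f x" by simp

lift_definition scaleR_fin_l2 :: "real \<Rightarrow> 'a fin_l2 \<Rightarrow> 'a fin_l2" is "\<lambda>r f x. r *\<^sub>R f x"
  by (erule rev_finite_subset) auto

instance
  by standard (transfer; simp add: fun_eq_iff algebra_simps)+

end

lift_definition cscale :: "complex \<Rightarrow> 'a fin_l2 \<Rightarrow> 'a fin_l2" is "\<lambda>c f x. c * f x"
  by (erule rev_finite_subset) auto

lift_definition delta :: "'a \<Rightarrow> 'a fin_l2" is "\<lambda>y x. if x = y then 1 else 0"
  by simp

lemmas entry_simps [simp] =
  zero_fin_l2.rep_eq plus_fin_l2.rep_eq minus_fin_l2.rep_eq uminus_fin_l2.rep_eq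
  scaleR_fin_l2.rep_eq cscale.rep_eq delta.rep_eq

lemma entry_sum: "entry (\<Sum>i\<in>I. F i) x = (\<Sum>i\<in>I. entry (F i) x)"
  by (induction I rule: infinite_finite_induct) simp_all

instantiation fin_l2 :: (type) real_inner
begin

definition inner_fin_l2 :: "'a fin_l2 \<Rightarrow> 'a fin_l2 \<Rightarrow> real" where
  "inner_fin_l2 f g = (\<Sum>x | entry f x \<noteq> 0. entry f x \<bullet> entry g x)"

definition norm_fin_l2 :: "'a fin_l2 \<Rightarrow> real" where
  "norm_fin_l2 f = sqrt (f \<bullet> f)"

definition dist_fin_l2 :: "'a fin_l2 \<Rightarrow> 'a fin_l2 \<Rightarrow> real" where
  "dist_fin_l2 f g = norm (f - g)"

definition sgn_fin_l2 :: "'a fin_l2 \<Rightarrow> 'a fin_l2" where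
  "sgn_fin_l2 f = f /\<^sub>R norm f"

definition uniformity_fin_l2 :: "('a fin_l2 \<times> 'a fin_l2) filter" where
  "uniformity_fin_l2 = (INF e\<in>{0<..}. principal {(f, g). dist f g < e})"

definition open_fin_l2 :: "'a fin_l2 set \<Rightarrow> bool" where
  "open_fin_l2 U \<longleftrightarrow> (\<forall>f\<in>U. \<forall>\<^sub>F (f', g) in uniformity. f' = f \<longrightarrow> g \<in> U)"

lemma inner_fin_l2_superset:
  assumes "finite S" and "{x. entry f x \<noteq> 0} \<subseteq> S"
  shows "f \<bullet> g = (\<Sum>x\<in>S. entry f x \<bullet> entry g x)"
  unfolding inner_fin_l2_def using assms by (intro sum.mono_neutral_left) auto

instance
proof
  fix f g h :: "'a fin_l2" and r :: real
  let ?S = "{x. entry f x \<noteq> 0} \<union> {x. entry g x \<noteq> 0}"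
  show "f \<bullet> g = g \<bullet> f"
    by (simp add: inner_fin_l2_superset[of ?S] inner_commute)
  show "(f + g) \<bullet> h = f \<bullet> h + g \<bullet> h"
  proof -
    have "{x. entry (f + g) x \<noteq> 0} \<subseteq> ?S" by auto
    then show ?thesis
      by (simp add: inner_fin_l2_superset[of ?S] inner_add_left sum.distrib)
  qed
  show "(r *\<^sub>R f) \<bullet> g = r * (f \<bullet> g)"
    by (subst (1 2) inner_fin_l2_superset[of "{x. entry f x \<noteq> 0}"]) (auto simp: sum_distrib_left)
  show "0 \<le> f \<bullet> f"
    by (simp add: inner_fin_l2_def sum_nonneg)
  show "f \<bullet> f = 0 \<longleftrightarrow> f = 0"
  proof
    assume "f \<bullet> f = 0"
    then have "\<forall>x\<in>{x. entry f x \<noteq> 0}. entry f x \<bullet> entry f x = 0"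
      unfolding inner_fin_l2_def by (subst (asm) sum_nonneg_eq_0_iff) auto
    then show "f = 0" by (intro fin_l2_eqI) auto
  qed (simp add: inner_fin_l2_def)
qed (simp_all add: norm_fin_l2_def dist_fin_l2_def sgn_fin_l2_def uniformity_fin_l2_def open_fin_l2_def)

end

lemma inner_cscale_left: "cscale c f \<bullet> g = f \<bullet> cscale (cnj c) g"
  by (subst (1 2) inner_fin_l2_superset[of "{x. entry f x \<noteq> 0}"])
     (auto simp: inner_complex_def algebra_simps intro!: sum.cong)

lemma norm_cscale: "norm (cscale c f) = cmod c * norm f"
proof -
  have "cscale c f \<bullet> cscale c f = (cmod c)\<^sup>2 * (f \<bullet> f)"
    by (subst (1 2) inner_fin_l2_superset[of "{x. entry f x \<noteq> 0}"])
       (auto simp: sum_distrib_left norm_mult power_mult_distrib simp flip: power2_norm_eq_inner)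
  then show ?thesis
    by (simp add: norm_eq_sqrt_inner real_sqrt_mult)
qed

text \<open>
  This is the $C^*$-identity for operators: with $S = T^*$, the Cauchy-Schwarz inequality
  yields $\|T^*\| \le \|T\|$, and $\|Tf\|^2 = \langle f, T^*Tf\rangle \le \|T^*T\|\,\|f\|^2$.
\<close>

lemma onorm_adjoint_compose:
  fixes S T :: "'a::real_inner \<Rightarrow> 'a"
  assumes T: "bounded_linear T" and S: "bounded_linear S"
    and adj: "\<And>f g. T f \<bullet> g = f \<bullet> S g"
  shows "onorm (S \<circ> T) = (onorm T)\<^sup>2"
proof (rule antisym)
  have "onorm S \<le> onorm T"
  proof (rule onorm_bound[OF onorm_pos_le[OF T]])
    fix g
    have "norm (S g) * norm (S g) = T (S g) \<bullet> g"
      by (simp add: adj flip: power2_norm_eq_inner power2_eq_square)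
    also have "\<dots> \<le> norm (T (S g)) * norm g"
      by (rule norm_cauchy_schwarz)
    also have "\<dots> \<le> onorm T * norm (S g) * norm g"
      by (intro mult_right_mono onorm T) simp
    finally show "norm (S g) \<le> onorm T * norm g"
      by (cases "norm (S g) = 0") (auto simp: onorm_pos_le[OF T] mult_ac)
  qed
  then show "onorm (S \<circ> T) \<le> (onorm T)\<^sup>2"
    using onorm_compose[OF S T] onorm_pos_le[OF T]
      mult_right_mono[of "onorm S" "onorm T" "onorm T"]
    by (simp add: power2_eq_square)
  have "onorm T \<le> sqrt (onorm (S \<circ> T))"
  proof (rule onorm_bound)
    have ST: "bounded_linear (S \<circ> T)"
      using bounded_linear_compose[OF S T] by (simp add: o_def)
    then show "0 \<le> sqrt (onorm (S \<circ> T))"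
      by (simp add: onorm_pos_le)
    fix f
    have "(norm (T f))\<^sup>2 = f \<bullet> (S \<circ> T) f"
      by (simp add: power2_norm_eq_inner adj)
    also have "\<dots> \<le> norm f * norm ((S \<circ> T) f)"
      by (rule norm_cauchy_schwarz)
    also have "\<dots> \<le> norm f * (onorm (S \<circ> T) * norm f)"
      by (intro mult_left_mono onorm ST) simp
    also have "\<dots> = (sqrt (onorm (S \<circ> T)) * norm f)\<^sup>2"
      by (simp add: power_mult_distrib onorm_pos_le[OF ST] power2_eq_square)
    finally show "norm (T f) \<le> sqrt (onorm (S \<circ> T)) * norm f"
      by (rule power2_le_imp_le) (simp add: onorm_pos_le[OF ST])
  qed
  then have "(onorm T)\<^sup>2 \<le> (sqrt (onorm (S \<circ> T)))\<^sup>2"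
    by (rule power_mono) (rule onorm_pos_le[OF T])
  also have "\<dots> = onorm (S \<circ> T)"
    using bounded_linear_compose[OF S T] by (simp add: o_def onorm_pos_le)
  finally show "(onorm T)\<^sup>2 \<le> onorm (S \<circ> T)" .
qed


section \<open>The action of the generators on infinite paths\<close>

definition paths :: "('i \<Rightarrow> 'i \<Rightarrow> nat) \<Rightarrow> (nat \<Rightarrow> 'i) set" where
  "paths A = {x. \<forall>n. A (x n) (x (Suc n)) \<noteq> 0}"

text \<open>
  Operators act on functions by pulling back along a partial map, so this is the partial map that
  belongs to the \<^emph>\<open>adjoint\<close> of the symbol: \<open>Gen i\<close> deletes an initial
  \<open>i\<close>, and \<open>Adj i\<close> prefixes one.  Pulling back also reverses the order of
  composition, which is why \<open>path_act\<close> reads a word from left to right although the product of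
  operators applies the last letter first.
\<close>

fun path_step :: "('i \<Rightarrow> 'i \<Rightarrow> nat) \<Rightarrow> 'i star_symbol \<Rightarrow> (nat \<Rightarrow> 'i) \<Rightarrow> (nat \<Rightarrow> 'i) option" where
  "path_step A (Gen i) x = (if x \<in> paths A \<and> x 0 = i then Some (\<lambda>n. x (Suc n)) else None)"
| "path_step A (Adj i) x = (if x \<in> paths A \<and> A i (x 0) \<noteq> 0 then Some (case_nat i x) else None)"

text \<open>
  The empty word acts as the identity of \<open>paths A\<close> only, so that the resulting
  representation lives on functions supported on admissible paths.  This avoids a type
  depending on \<open>A\<close>, at the price of a representation that is not unital.
\<close>

fun path_act :: "('i \<Rightarrow> 'i \<Rightarrow> nat) \<Rightarrow> 'i star_symbol list \<Rightarrow> (nat \<Rightarrow> 'i) \<Rightarrow> (nat \<Rightarrow> 'i) option" where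
  "path_act A [] x = (if x \<in> paths A then Some x else None)"
| "path_act A (s # u) x = Option.bind (path_step A s x) (path_act A u)"

lemma tail_in_paths: "x \<in> paths A \<Longrightarrow> (\<lambda>n. x (Suc n)) \<in> paths A"
  by (simp add: paths_def)

lemma cons_in_paths: "case_nat i x \<in> paths A \<longleftrightarrow> A i (x 0) \<noteq> 0 \<and> x \<in> paths A"
  by (auto simp: paths_def split: nat.splits)

lemma path_step_in_paths:
  assumes "path_step A s x = Some y"
  shows "x \<in> paths A" "y \<in> paths A"
  using assms by (cases s; auto simp: tail_in_paths cons_in_paths split: if_splits)+

lemma case_nat_tail: "case_nat (x 0) (\<lambda>n. x (Suc n)) = x"
  by (auto simp: fun_eq_iff split: nat.splits)

lemma path_step_converse_imp:
  "path_step A s x = Some y \<Longrightarrow> path_step A (adj_symbol s) y = Some x"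
proof (cases s)
  case (Gen i)
  assume "path_step A s x = Some y"
  then have "x \<in> paths A" "x 0 = i" "y = (\<lambda>n. x (Suc n))"
    using Gen by (auto split: if_splits)
  moreover from this have "A (x 0) (x (Suc 0)) \<noteq> 0" "case_nat i y = x"
    using case_nat_tail[of x] unfolding paths_def by blast+
  ultimately show ?thesis
    using Gen tail_in_paths by auto
next
  case (Adj i)
  assume "path_step A s x = Some y"
  then show ?thesis
    using Adj by (auto simp: cons_in_paths split: if_splits)
qed

lemma path_step_converse:
  "path_step A s x = Some y \<longleftrightarrow> path_step A (adj_symbol s) y = Some x"
  using path_step_converse_imp[of A s x y] path_step_converse_imp[of A "adj_symbol s" y x] by auto

lemma path_act_in_paths: "path_act A u x = Some y \<Longrightarrow> x \<in> paths A \<and> y \<in> paths A"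
proof (induction u arbitrary: x)
  case (Cons s u)
  then show ?case by (auto simp: bind_eq_Some_conv dest: path_step_in_paths)
qed (simp split: if_splits)

lemma path_act_append: "path_act A (u @ v) x = Option.bind (path_act A u x) (path_act A v)"
proof (induction u arbitrary: x)
  case Nil
  show ?case
    by (cases "path_act A v x") (auto dest: path_act_in_paths)
next
  case (Cons s u)
  then show ?case by (cases "path_step A s x") simp_all
qed

lemma path_act_singleton: "path_act A [s] = path_step A s"
proof
  fix x show "path_act A [s] x = path_step A s x"
    by (cases "path_step A s x") (auto dest: path_step_in_paths)
qed

lemma path_act_converse:
  "path_act A u x = Some y \<longleftrightarrow> path_act A (rev (map adj_symbol u)) y = Some x"
proof (induction u arbitrary: x)
  case (Cons s u)
  have "path_act A (s # u) x = Some y \<longleftrightarrow> (\<exists>z. path_step A s x = Some z \<and> path_act A u z = Some y)"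
    by (simp add: bind_eq_Some_conv)
  also have "\<dots> \<longleftrightarrow> (\<exists>z. path_act A (rev (map adj_symbol u)) y = Some z \<and>
      path_step A (adj_symbol s) z = Some x)"
    using Cons.IH path_step_converse by blast
  finally show ?case
    by (simp add: path_act_append path_act_singleton bind_eq_Some_conv del: path_act.simps)
qed auto

section \<open>The path representation and its norm\<close>

lift_definition path_op ::
  "('i \<Rightarrow> 'i \<Rightarrow> nat) \<Rightarrow> 'i star_symbol list \<Rightarrow> (nat \<Rightarrow> 'i) fin_l2 \<Rightarrow> (nat \<Rightarrow> 'i) fin_l2"
  is "\<lambda>A u f x. case path_act A u x of None \<Rightarrow> 0 | Some y \<Rightarrow> f y"
proof -
  fix A :: "'i \<Rightarrow> 'i \<Rightarrow> nat" and u and f :: "(nat \<Rightarrow> 'i) \<Rightarrow> complex"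
  assume "finite {x. f x \<noteq> 0}"
  then have "finite ((\<lambda>y. the (path_act A (rev (map adj_symbol u)) y)) ` {y. f y \<noteq> 0})"
    by simp
  then show "finite {x. (case path_act A u x of None \<Rightarrow> 0 | Some y \<Rightarrow> f y) \<noteq> 0}"
  proof (rule rev_finite_subset, safe)
    fix x assume *: "(case path_act A u x of None \<Rightarrow> 0 | Some y \<Rightarrow> f y) \<noteq> 0"
    then obtain y where y: "path_act A u x = Some y" "f y \<noteq> 0"
      by (auto split: option.splits)
    then have "x = the (path_act A (rev (map adj_symbol u)) y)"
      using path_act_converse[of A u x y] by simp
    with y show "x \<in> (\<lambda>y. the (path_act A (rev (map adj_symbol u)) y)) ` {y. f y \<noteq> 0}"
      by blast
  qed
qed

lemma entry_path_op [simp]: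
  "entry (path_op A u f) x = (case path_act A u x of None \<Rightarrow> 0 | Some y \<Rightarrow> entry f y)"
  by (simp add: path_op.rep_eq)

lemma path_op_add: "path_op A u (f + g) = path_op A u f + path_op A u g"
  and path_op_cscale: "path_op A u (cscale c f) = cscale c (path_op A u f)"
  and path_op_scaleR: "path_op A u (r *\<^sub>R f) = r *\<^sub>R path_op A u f"
  by (rule fin_l2_eqI; simp split: option.splits)+

lemma path_op_append: "path_op A (u @ v) f = path_op A u (path_op A v f)"
  by (rule fin_l2_eqI) (simp add: path_act_append split: option.splits)

text \<open>Both sides sum over the graph of the partial bijection \<open>path_act A u\<close>.\<close>

lemma path_op_adjoint:
  "path_op A u f \<bullet> g = f \<bullet> path_op A (rev (map adj_symbol u)) g"
proof -
  let ?v = "rev (map adj_symbol u)"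
  let ?i = "\<lambda>y. the (path_act A ?v y)" and ?j = "\<lambda>x. the (path_act A u x)"
  let ?S = "{x. entry (path_op A u f) x \<noteq> 0}"
    and ?T' = "{y. entry f y \<noteq> 0 \<and> path_act A ?v y = None}"
  have S: "\<exists>y. path_act A u x = Some y \<and> path_act A ?v y = Some x \<and> entry f y \<noteq> 0"
    if "x \<in> ?S" for x
    using that path_act_converse[of A u x] by (auto split: option.splits)
  have T: "\<exists>x. path_act A u x = Some y \<and> path_act A ?v y = Some x \<and> entry f y \<noteq> 0"
    if "y \<in> {y. entry f y \<noteq> 0} - ?T'" for y
    using that path_act_converse[of A u _ y] by auto
  have "(\<Sum>x\<in>?S. entry (path_op A u f) x \<bullet> entry g x)
      = (\<Sum>y | entry f y \<noteq> 0. entry f y \<bullet> entry (path_op A ?v g) y)"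
    by (rule sum.reindex_bij_witness_not_neutral[where S' = "{}" and T' = ?T' and i = ?i and j = ?j])
       (use S T in fastforce)+
  then show ?thesis
    by (simp add: inner_fin_l2_def)
qed

lemma norm_path_op_le: "norm (path_op A u f) \<le> norm f"
proof -
  let ?S = "{x. entry (path_op A u f) x \<noteq> 0}" and ?j = "\<lambda>x. the (path_act A u x)"
  have inj: "inj_on ?j ?S"
  proof (rule inj_onI)
    fix x x' assume "x \<in> ?S" "x' \<in> ?S" "?j x = ?j x'"
    then obtain y where "path_act A u x = Some y" "path_act A u x' = Some y"
      by (auto split: option.splits)
    then show "x = x'" by (simp add: path_act_converse[of A u])
  qed
  have "path_op A u f \<bullet> path_op A u f = (\<Sum>x\<in>?S. entry f (?j x) \<bullet> entry f (?j x))"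
    unfolding inner_fin_l2_def by (rule sum.cong) (auto split: option.splits)
  also have "\<dots> = (\<Sum>y\<in>?j ` ?S. entry f y \<bullet> entry f y)"
    by (rule sum.reindex[OF inj, unfolded o_def, symmetric])
  also have "\<dots> \<le> f \<bullet> f"
    unfolding inner_fin_l2_def by (rule sum_mono2) (auto split: option.splits)
  finally show ?thesis
    by (simp add: norm_eq_sqrt_inner)
qed

fun symbols :: "'i star_word \<Rightarrow> 'i star_symbol list" where
  "symbols (Word u) = u"

lemma symbols_plus: "symbols (v + w) = symbols v @ symbols w"
  by (cases v; cases w) simp

lemma symbols_adj_word: "symbols (adj_word w) = rev (map adj_symbol (symbols w))"
  by (cases w) simp

definition path_rep ::
  "('i \<Rightarrow> 'i \<Rightarrow> nat) \<Rightarrow> 'i free_star_alg \<Rightarrow> (nat \<Rightarrow> 'i) fin_l2 \<Rightarrow> (nat \<Rightarrow> 'i) fin_l2" where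
  "path_rep A a f =
    (\<Sum>w\<in>Poly_Mapping.keys a. cscale (Poly_Mapping.lookup a w) (path_op A (symbols w) f))"

lemma cscale_0 [simp]: "cscale 0 f = 0"
  and cscale_zero_right [simp]: "cscale c 0 = 0"
  and cscale_1 [simp]: "cscale 1 f = f"
  and cscale_cscale: "cscale c (cscale d f) = cscale (c * d) f"
  and cscale_add_left: "cscale (c + d) f = cscale c f + cscale d f"
  and cscale_add_right: "cscale c (f + g) = cscale c f + cscale c g"
  and cscale_scaleR: "cscale c (r *\<^sub>R f) = r *\<^sub>R cscale c f"
  by (rule fin_l2_eqI; simp add: algebra_simps)+

lemma path_rep_single: "path_rep A (Poly_Mapping.single w c) f = cscale c (path_op A (symbols w) f)"
  by (simp add: path_rep_def)

lemma path_rep_add_left: "path_rep A (a + b) f = path_rep A a f + path_rep A b f"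
  unfolding path_rep_def
  by (rule setsum_keys_plus_distrib) (simp_all add: cscale_add_left)

lemma path_rep_diff_left: "path_rep A (a - b) f = path_rep A a f - path_rep A b f"
  using path_rep_add_left[of A "a - b" b f] by simp

lemma path_rep_sum_left: "path_rep A (\<Sum>i\<in>I. F i) f = (\<Sum>i\<in>I. path_rep A (F i) f)"
  by (induction I rule: infinite_finite_induct) (simp_all add: path_rep_add_left path_rep_def[of A 0])

lemma path_rep_free_scale: "path_rep A (free_scale c a) f = cscale c (path_rep A a f)"
proof (induction a rule: poly_mapping_induct_single)
  case (single w d)
  then show ?case by (simp add: free_scale_def mult_single path_rep_single cscale_cscale)
next
  case (add a b)
  then show ?case by (simp add: free_scale_def distrib_left path_rep_add_left cscale_add_right)
qed

lemma bounded_linear_path_rep: "bounded_linear (path_rep A a)"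
proof (induction a rule: poly_mapping_induct_single)
  case (single w c)
  have "norm (cscale c (path_op A (symbols w) f)) \<le> norm f * cmod c" for f
    by (simp add: norm_cscale norm_path_op_le mult_left_mono mult.commute[of "norm f"])
  then show ?case
    by (intro bounded_linear_intro[of _ "cmod c"])
       (simp_all add: path_rep_single path_op_add path_op_scaleR cscale_add_right cscale_scaleR)
next
  case (add a b)
  then show ?case
    using bounded_linear_add by (simp add: path_rep_add_left[abs_def])
qed

lemma path_rep_mult: "path_rep A (a * b) f = path_rep A a (path_rep A b f)"
proof (induction a rule: poly_mapping_induct_single)
  case (single v c)
  show ?case
  proof (induction b rule: poly_mapping_induct_single)
    case (single w d)
    then show ?case
      by (simp add: mult_single path_rep_single symbols_plus path_op_append path_op_cscale cscale_cscale)
  next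
    case (add a b)
    then show ?case
      by (simp add: distrib_left path_rep_add_left
          linear_add[OF bounded_linear.linear[OF bounded_linear_path_rep]])
  qed
next
  case (add a b)
  then show ?case by (simp add: distrib_right path_rep_add_left)
qed

lemma path_rep_adjoint: "path_rep A a f \<bullet> g = f \<bullet> path_rep A (free_star a) g"
proof (induction a rule: poly_mapping_induct_single)
  case (single w c)
  then show ?case
    by (simp add: path_rep_single free_star_single inner_cscale_left path_op_adjoint symbols_adj_word
        flip: path_op_cscale)
next
  case (add a b)
  then show ?case by (simp add: path_rep_add_left free_star_add inner_add_left inner_add_right)
qed

definition path_norm :: "('i \<Rightarrow> 'i \<Rightarrow> nat) \<Rightarrow> 'i free_star_alg \<Rightarrow> real" where
  "path_norm A a = onorm (path_rep A a)"

lemma path_norm_eq_0_iff: "path_norm A a = 0 \<longleftrightarrow> (\<forall>f. path_rep A a f = 0)"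
  by (simp add: path_norm_def onorm_eq_0 bounded_linear_path_rep)

lemma cstar_seminorm_path_norm:
  fixes A :: "'i \<Rightarrow> 'i \<Rightarrow> nat"
  shows "cstar_seminorm (path_norm A)"
  unfolding cstar_seminorm_def path_norm_def
proof (intro conjI allI)
  fix a b :: "'i free_star_alg" and c :: complex
  note [simp] = bounded_linear_path_rep
  have mult: "path_rep A (x * y) = path_rep A x \<circ> path_rep A y" for x y
    by (simp add: path_rep_mult fun_eq_iff)
  show "0 \<le> onorm (path_rep A a)"
    by (simp add: onorm_pos_le)
  show "onorm (path_rep A (a + b)) \<le> onorm (path_rep A a) + onorm (path_rep A b)"
    using onorm_triangle[of "path_rep A a" "path_rep A b"] by (simp add: path_rep_add_left[abs_def])
  have "onorm (path_rep A (free_scale c a)) = onorm (\<lambda>f. cmod c *\<^sub>R path_rep A a f)"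
    by (simp add: onorm_def path_rep_free_scale norm_cscale)
  then show "onorm (path_rep A (free_scale c a)) = cmod c * onorm (path_rep A a)"
    by (simp add: onorm_scaleR)
  show "onorm (path_rep A (a * b)) \<le> onorm (path_rep A a) * onorm (path_rep A b)"
    by (simp add: mult onorm_compose)
  show "onorm (path_rep A (free_star a * a)) = (onorm (path_rep A a))\<^sup>2"
    unfolding mult by (rule onorm_adjoint_compose) (simp_all add: path_rep_adjoint)
qed

lemma path_rep_word_monomial: "path_rep A (word_monomial u) f = path_op A u f"
  by (simp add: word_monomial_def path_rep_single)

lemma path_act_range: "path_act A [Gen i, Adj i] x = (if x \<in> paths A \<and> x 0 = i then Some x else None)"
  by (auto simp: case_nat_tail tail_in_paths cons_in_paths paths_def)

lemma path_act_domain: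
  "path_act A [Adj i, Gen i] x = (if x \<in> paths A \<and> A i (x 0) \<noteq> 0 then Some x else None)"
  by (auto simp: cons_in_paths)

text \<open>
  The initial letter partitions the paths, which gives $\sum_j t_j t_j^* = 1$.  A path $x$ can be
  prefixed with $i$ if and only if $A(i, x_0) \neq 0$, which gives the formula for $t_i^* t_i$; there the
  coefficient $A(i, x_0)$ has to be exactly $1$ when it is not $0$.
\<close>

lemma ck_seminorm_path_norm:
  fixes A :: "'i::finite \<Rightarrow> 'i \<Rightarrow> nat"
  assumes A: "\<And>i j. A i j \<le> 1"
  shows "ck_seminorm A (path_norm A)"
  unfolding ck_seminorm_def
proof (intro conjI allI cstar_seminorm_path_norm)
  fix i :: 'i
  have range: "free_gen j * free_star (free_gen j) = word_monomial [Gen j, Adj j]" for j :: 'i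
    by (simp add: free_gen_eq free_star_word_monomial flip: word_monomial_append)
  have domain: "free_star (free_gen i) * free_gen i = word_monomial [Adj i, Gen i]"
    by (simp add: free_gen_eq free_star_word_monomial flip: word_monomial_append)
  have triple: "free_gen i * free_star (free_gen i) * free_gen i = word_monomial [Gen i, Adj i, Gen i]"
    by (simp add: free_gen_eq free_star_word_monomial flip: word_monomial_append)
  have "path_act A ([Gen i, Adj i] @ [Gen i]) = path_act A [Gen i]"
    by (rule ext, subst path_act_append) (simp add: path_act_range path_act_singleton del: path_act.simps)
  then have "path_op A [Gen i, Adj i, Gen i] f = path_op A [Gen i] f" for f
    by (intro fin_l2_eqI) (simp del: path_act.simps)
  then show "path_norm A (free_gen i * free_star (free_gen i) * free_gen i - free_gen i) = 0"
    unfolding triple path_norm_eq_0_iff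
    by (simp add: free_gen_eq path_rep_diff_left path_rep_word_monomial)
  have partition: "entry (path_rep A (free_gen j * free_star (free_gen j)) f) x =
      (if x \<in> paths A \<and> x 0 = j then entry f x else 0)" for j f x
    by (simp add: range path_rep_word_monomial path_act_range del: path_act.simps)
  show "path_norm A ((\<Sum>j\<in>UNIV. free_gen j * free_star (free_gen j)) - 1) = 0"
    unfolding path_norm_eq_0_iff word_monomial_Nil[symmetric]
  proof (intro allI fin_l2_eqI)
    fix f and x :: "nat \<Rightarrow> 'i"
    show "entry (path_rep A ((\<Sum>j\<in>UNIV. free_gen j * free_star (free_gen j)) - word_monomial []) f) x
        = entry 0 x"
      by (cases "x \<in> paths A")
         (simp_all add: path_rep_diff_left path_rep_sum_left entry_sum partition path_rep_word_monomial)
  qed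
  show "path_norm A (free_star (free_gen i) * free_gen i -
      (\<Sum>j\<in>UNIV. of_nat (A i j) * (free_gen j * free_star (free_gen j)))) = 0"
    unfolding path_norm_eq_0_iff
  proof (intro allI fin_l2_eqI)
    fix f and x :: "nat \<Rightarrow> 'i"
    have scale: "of_nat n * a = free_scale (of_nat n) a" for n and a :: "'i free_star_alg"
      by (simp add: free_scale_def)
    have "A i (x 0) = 0 \<or> A i (x 0) = 1"
      using A[of i "x 0"] by linarith
    then show "entry (path_rep A (free_star (free_gen i) * free_gen i -
        (\<Sum>j\<in>UNIV. of_nat (A i j) * (free_gen j * free_star (free_gen j)))) f) x = entry 0 x"
      by (cases "x \<in> paths A")
         (auto simp: path_rep_diff_left path_rep_sum_left entry_sum partition path_rep_word_monomial
           scale path_rep_free_scale domain path_act_domain if_distrib[of "\<lambda>z. _ * z"]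
           simp del: path_act.simps cong: if_cong)
  qed
qed

text \<open>If the word moves some path, then its operator does not kill a point mass.\<close>

lemma not_forbidden_if_path_act:
  fixes A :: "'i::finite \<Rightarrow> 'i \<Rightarrow> nat"
  assumes A: "\<And>i j. A i j \<le> 1" and act: "path_act A (map letter_symbol w) x = Some y"
  shows "\<not> forbidden A w"
proof -
  have "entry (path_rep A (word_monomial (map letter_symbol w)) (delta y)) x = 1"
    by (simp add: path_rep_word_monomial act)
  then have "path_norm A (word_monomial (map letter_symbol w)) \<noteq> 0"
    unfolding path_norm_eq_0_iff by (metis zero_neq_one zero_fin_l2.rep_eq)
  then show ?thesis
    using ck_seminorm_path_norm[of A, OF A] by (auto simp: forbidden_iff_ck_seminorms)
qed

lemma markov_dyck_shift_if_orbit: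
  fixes A :: "'i::finite \<Rightarrow> 'i \<Rightarrow> nat"
  assumes A: "\<And>i j. A i j \<le> 1"
    and orbit: "\<And>k. path_step A (letter_symbol (z k)) (y k) = Some (y (k + 1))"
  shows "z \<in> markov_dyck_shift A"
proof -
  have "path_act A (map letter_symbol (map (\<lambda>m. z (k + int m)) [0..<n])) (y k) = Some (y (k + int n))"
    for k n
  proof (induction n arbitrary: k)
    case 0
    show ?case using path_step_in_paths(1)[OF orbit[of k]] by simp
  next
    case (Suc n)
    have "map (\<lambda>m. z (k + int m)) [0..<Suc n] = z k # map (\<lambda>m. z (k + 1 + int m)) [0..<n]"
      unfolding upt_conv_Cons[OF zero_less_Suc] map_Suc_upt[symmetric] by (simp add: add_ac)
    then show ?case
      using Suc.IH[of "k + 1"] orbit[of k] by (simp add: add_ac)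
  qed
  then show ?thesis
    unfolding markov_dyck_shift_def using not_forbidden_if_path_act[of A, OF A] by blast
qed


section \<open>Points fixed by the second power of the shift\<close>

definition two_periodic :: "(int \<Rightarrow> 'a) set \<Rightarrow> (int \<Rightarrow> 'a) set" where
  "two_periodic X = {x \<in> X. shift (shift x) = x}"

lemma shift_in_markov_dyck_shift:
  assumes "x \<in> markov_dyck_shift A"
  shows "shift x \<in> markov_dyck_shift A"
proof -
  have window: "map (\<lambda>m. shift x (k + int m)) [0..<n] = map (\<lambda>m. x ((k + 1) + int m)) [0..<n]" for k n
    by (simp add: shift_def add_ac)
  then show ?thesis
    using assms unfolding markov_dyck_shift_def mem_Collect_eq window by blast
qed

lemma topspace_full_shift_topology [simp]: "topspace full_shift_topology = UNIV"
  by (simp add: full_shift_topology_def)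

lemma topologically_conjugate_two_periodic:
  assumes conj: "topologically_conjugate X Y" and X: "\<And>x. x \<in> X \<Longrightarrow> shift x \<in> X"
  obtains h where "bij_betw h (two_periodic X) (two_periodic Y)"
proof -
  obtain h where h: "homeomorphic_map (subtopology full_shift_topology X) (subtopology full_shift_topology Y) h"
      and comm: "\<And>x. x \<in> X \<Longrightarrow> h (shift x) = shift (h x)"
    using conj by (auto simp: topologically_conjugate_def)
  have inj: "inj_on h X" and surj: "h ` X = Y"
    using homeomorphic_imp_injective_map[OF h] homeomorphic_imp_surjective_map[OF h] by simp_all
  have "h (shift (shift x)) = shift (shift (h x))" if "x \<in> X" for x
    using that X comm by simp
  then have "shift (shift (h x)) = h x \<longleftrightarrow> shift (shift x) = x" if "x \<in> X" for x
    using that X inj by (metis inj_on_eq_iff)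
  then have "h ` two_periodic X = two_periodic Y"
    using surj by (auto simp: two_periodic_def)
  moreover have "inj_on h (two_periodic X)"
    using inj by (rule inj_on_subset) (auto simp: two_periodic_def)
  ultimately show thesis
    using that by (simp add: bij_betw_def)
qed

definition alternating :: "'a \<Rightarrow> 'a \<Rightarrow> int \<Rightarrow> 'a" where
  "alternating a b k = (if even k then a else b)"

lemma two_periodic_eq_alternating:
  assumes "shift (shift x) = x"
  shows "x = alternating (x 0) (x 1)"
proof
  fix k :: int
  have step: "x (k + 2) = x k" for k
    using fun_cong[OF assms, of k] by (simp add: shift_def add_ac)
  have "x (2 * j + i) = x i" for i j
  proof (induction j rule: int_induct[of _ 0])
    case (step1 j)
    then show ?case using step[of "2 * j + i"] by (simp add: algebra_simps)
  next
    case (step2 j)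
    then show ?case using step[of "2 * (j - 1) + i"] by (simp add: algebra_simps)
  qed simp
  then have "x k = x (k mod 2)"
    by (metis mult_div_mod_eq)
  then show "x k = alternating (x 0) (x 1) k"
    by (simp add: alternating_def mod_2_eq_odd)
qed

lemma shift_alternating [simp]: "shift (alternating a b) = alternating b a"
  by (auto simp: shift_def alternating_def fun_eq_iff)

lemma alternating_eq_iff: "alternating a b = alternating c d \<longleftrightarrow> a = c \<and> b = d"
proof
  assume "alternating a b = alternating c d"
  from fun_cong[OF this, of 0] fun_cong[OF this, of 1] show "a = c \<and> b = d"
    by (simp add: alternating_def)
qed simp

text \<open>
  For a $\{0,1\}$-matrix without zero rows these are the pairs of letters whose alternating
  sequence belongs to the Markov-Dyck shift.  Since
  $t_i^* t_j^* = (t_j t_i)^*$, two \<open>Alpha\<close>s impose the same condition as two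
  \<open>Beta\<close>s: a closed walk of length two.
\<close>

fun dyck_pair :: "('i \<Rightarrow> 'i \<Rightarrow> nat) \<Rightarrow> 'i dyck_letter \<Rightarrow> 'i dyck_letter \<Rightarrow> bool" where
  "dyck_pair A (Alpha i) (Alpha j) \<longleftrightarrow> A i j \<noteq> 0 \<and> A j i \<noteq> 0"
| "dyck_pair A (Beta i) (Beta j) \<longleftrightarrow> A i j \<noteq> 0 \<and> A j i \<noteq> 0"
| "dyck_pair A (Alpha i) (Beta j) \<longleftrightarrow> i = j"
| "dyck_pair A (Beta i) (Alpha j) \<longleftrightarrow> j = i"

lemma card_dyck_pair:
  fixes A :: "'i::finite \<Rightarrow> 'i \<Rightarrow> nat"
  shows "card {(a, b). dyck_pair A a b} = 2 * card {(i, j). A i j \<noteq> 0 \<and> A j i \<noteq> 0} + 2 * CARD('i)"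
proof -
  let ?C = "{(i, j). A i j \<noteq> 0 \<and> A j i \<noteq> 0}"
  let ?AA = "map_prod Alpha Alpha ` ?C" and ?BB = "map_prod Beta Beta ` ?C"
    and ?AB = "range (\<lambda>i::'i. (Alpha i, Beta i))" and ?BA = "range (\<lambda>i::'i. (Beta i, Alpha i))"
  have "{(a, b). dyck_pair A a b} = (?AA \<union> ?BB) \<union> (?AB \<union> ?BA)" (is "?L = ?R")
  proof (intro equalityI subsetI)
    fix x assume "x \<in> ?L"
    then show "x \<in> ?R"
      by (cases x; cases "fst x"; cases "snd x") (auto simp: image_iff)
  qed auto
  also have "card \<dots> = card (?AA \<union> ?BB) + card (?AB \<union> ?BA)"
    by (rule card_Un_disjoint) auto
  also have "card (?AA \<union> ?BB) = card ?AA + card ?BB"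
    by (rule card_Un_disjoint) auto
  also have "card (?AB \<union> ?BA) = card ?AB + card ?BA"
    by (rule card_Un_disjoint) auto
  also have "card ?AA = card ?C"
    by (rule card_image) (auto simp: inj_on_def)
  also have "card ?BB = card ?C"
    by (rule card_image) (auto simp: inj_on_def)
  also have "card ?AB = CARD('i)"
    by (rule card_image) (auto simp: inj_on_def)
  also have "card ?BA = CARD('i)"
    by (rule card_image) (auto simp: inj_on_def)
  finally show ?thesis by simp
qed

lemma finite_dyck_pair: "finite {(a, b). dyck_pair A a b}" for A :: "'i::finite \<Rightarrow> 'i \<Rightarrow> nat"
proof -
  have "x \<in> range Alpha \<union> range Beta" for x :: "'i dyck_letter"
    by (cases x) auto
  then have "(UNIV :: 'i dyck_letter set) = range Alpha \<union> range Beta"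
    by blast
  then have "finite (UNIV :: 'i dyck_letter set)"
    by (metis finite_Un finite_imageI finite_class.finite_UNIV)
  then have "finite (UNIV :: ('i dyck_letter \<times> 'i dyck_letter) set)"
    by (simp add: finite_prod)
  then show ?thesis by (rule rev_finite_subset) simp
qed

text \<open>
  In each case two paths \<open>y\<close>, \<open>z\<close> are exchanged by the two letters, and
  alternating between them is an orbit.  For a closed walk these are the two periodic paths along
  the walk.  For an \<open>Alpha\<close> and a \<open>Beta\<close> with the same index \<open>i\<close>, a path starting
  with \<open>i\<close> loses and regains that letter; such a path exists because no row of the matrix is zero.
\<close>

lemma alternating_in_markov_dyck_shift:
  fixes A :: "'i::finite \<Rightarrow> 'i \<Rightarrow> nat"
  assumes A: "\<And>i j. A i j \<le> 1" and rows: "\<And>i. \<exists>j. A i j \<noteq> 0" and pair: "dyck_pair A a b"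
  shows "alternating a b \<in> markov_dyck_shift A"
proof -
  have orbit: "alternating a b \<in> markov_dyck_shift A"
    if "path_step A (letter_symbol a) y = Some z" "path_step A (letter_symbol b) z = Some y" for y z
    by (rule markov_dyck_shift_if_orbit[of A _ "alternating y z", OF A])
       (use that in \<open>auto simp: alternating_def\<close>)
  have circuit: "(\<lambda>n. if even n then i else j) \<in> paths A" if "A i j \<noteq> 0" "A j i \<noteq> 0" for i j
    using that by (auto simp: paths_def)
  have walk: "\<exists>x \<in> paths A. x 0 = i" for i
  proof -
    obtain succ where "\<And>j. A j (succ j) \<noteq> 0" using rows by metis
    then have "(\<lambda>n. (succ ^^ n) i) \<in> paths A" by (simp add: paths_def)
    then show ?thesis by (rule bexI[rotated]) simp
  qed
  have pop_push: "\<exists>x y. path_step A (Gen i) x = Some y \<and> path_step A (Adj i) y = Some x" for i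
  proof -
    obtain x where "x \<in> paths A" "x 0 = i" using walk by blast
    then have step: "path_step A (Gen i) x = Some (\<lambda>n. x (Suc n))" by simp
    from path_step_converse_imp[OF step] have "path_step A (Adj i) (\<lambda>n. x (Suc n)) = Some x"
      by (simp only: adj_symbol.simps)
    with step show ?thesis by blast
  qed
  have turn: "path_step A (Gen i) (\<lambda>n. if even n then i else j) = Some (\<lambda>n. if even n then j else i)"
    if "A i j \<noteq> 0" "A j i \<noteq> 0" for i j
    using circuit[OF that] by (auto simp: fun_eq_iff)
  show ?thesis
  proof (cases a; cases b)
    fix i j assume ab: "a = Alpha i" "b = Alpha j"
    then have *: "A i j \<noteq> 0" "A j i \<noteq> 0" using pair by auto
    show ?thesis
      using orbit[of "\<lambda>n. if even n then j else i" "\<lambda>n. if even n then i else j"]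
        turn[of i j, THEN path_step_converse_imp] turn[of j i, THEN path_step_converse_imp] * ab
      by (simp del: path_step.simps)
  next
    fix i j assume ab: "a = Beta i" "b = Beta j"
    then have *: "A i j \<noteq> 0" "A j i \<noteq> 0" using pair by auto
    show ?thesis
      using orbit[of "\<lambda>n. if even n then i else j" "\<lambda>n. if even n then j else i"]
        turn[of i j] turn[of j i] * ab
      by (simp del: path_step.simps)
  next
    fix i j assume ab: "a = Alpha i" "b = Beta j"
    obtain x y where "path_step A (Gen i) x = Some y" "path_step A (Adj i) y = Some x"
      using pop_push by blast
    with ab pair show ?thesis
      by (intro orbit[of y x]) (simp_all del: path_step.simps)
  next
    fix i j assume ab: "a = Beta i" "b = Alpha j"
    obtain x y where "path_step A (Gen i) x = Some y" "path_step A (Adj i) y = Some x"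
      using pop_push by blast
    with ab pair show ?thesis
      by (intro orbit[of x y]) (simp_all del: path_step.simps)
  qed
qed

lemma card_two_periodic_ge:
  fixes A :: "'i::finite \<Rightarrow> 'i \<Rightarrow> nat"
  assumes A: "\<And>i j. A i j \<le> 1" and rows: "\<And>i. \<exists>j. A i j \<noteq> 0"
    and fin: "finite (two_periodic (markov_dyck_shift A))"
  shows "card {(a, b). dyck_pair A a b} \<le> card (two_periodic (markov_dyck_shift A))"
proof (rule card_inj_on_le[OF _ _ fin])
  show "inj_on (\<lambda>(a, b). alternating a b) {(a, b). dyck_pair A a b}"
    by (auto simp: inj_on_def alternating_eq_iff)
  show "(\<lambda>(a, b). alternating a b) ` {(a, b). dyck_pair A a b} \<subseteq> two_periodic (markov_dyck_shift A)"
    using alternating_in_markov_dyck_shift[of A, OF A rows] by (auto simp: two_periodic_def)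
qed

lemma not_forbidden_window:
  assumes "x \<in> markov_dyck_shift A"
  shows "\<not> forbidden A [x k, x (k + 1)]"
proof -
  have "\<not> forbidden A (map (\<lambda>m. x (k + int m)) [0..<2])"
    using assms by (simp add: markov_dyck_shift_def)
  then show ?thesis by (simp add: numeral_2_eq_2)
qed

text \<open>
  The hypothesis on the number of generators gives orthogonality of the ranges by plain algebra;
  for more than two generators it is a consequence of positivity in $C^*$-algebras.
\<close>

lemma forbidden_two_letters:
  fixes A :: "'i::finite \<Rightarrow> 'i \<Rightarrow> nat"
  assumes two: "CARD('i) = 2"
  shows "i \<noteq> j \<Longrightarrow> forbidden A [Alpha i, Beta j]"
    and "A i j = 0 \<Longrightarrow> forbidden A [Beta i, Beta j]"
    and "A i j = 0 \<Longrightarrow> forbidden A [Alpha j, Alpha i]"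
proof -
  have UNIV: "UNIV = {k, l}" if "k \<noteq> l" for k l :: 'i
    using card_subset_eq[of UNIV "{k, l}"] two that by simp
  have orth: "p (free_star (free_gen k) * free_gen l) = 0" if "ck_seminorm A p" "k \<noteq> l" for p k l
    using ck_orthogonal_ranges[OF that(1) UNIV[OF that(2)] that(2)] .
  then show "i \<noteq> j \<Longrightarrow> forbidden A [Alpha i, Beta j]"
    by (simp add: forbidden_iff_ck_seminorms free_gen_eq free_star_word_monomial
        flip: word_monomial_append)
  have prod: "p (word_monomial [Gen i, Gen j]) = 0" if "A i j = 0" "ck_seminorm A p" for p
    using ck_gen_product_null[OF that(2) orth[OF that(2)] that(1)]
    by (simp add: free_gen_eq flip: word_monomial_append)
  then show "A i j = 0 \<Longrightarrow> forbidden A [Beta i, Beta j]"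
    by (simp add: forbidden_iff_ck_seminorms)
  have "p (word_monomial [Adj j, Adj i]) = 0" if "A i j = 0" "ck_seminorm A p" for p
    using prod[OF that] cstar_seminorm_star[OF ck_seminormD(1)[OF that(2)], of "word_monomial [Gen i, Gen j]"]
    by (simp add: free_star_word_monomial)
  then show "A i j = 0 \<Longrightarrow> forbidden A [Alpha j, Alpha i]"
    by (simp add: forbidden_iff_ck_seminorms)
qed

lemma two_periodic_dyck_pair:
  fixes A :: "'i::finite \<Rightarrow> 'i \<Rightarrow> nat"
  assumes two: "CARD('i) = 2" and x: "x \<in> two_periodic (markov_dyck_shift A)"
  shows "dyck_pair A (x 0) (x 1)"
proof -
  have "x \<in> markov_dyck_shift A" and per: "shift (shift x) = x"
    using x by (auto simp: two_periodic_def)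
  note nf = not_forbidden_window[OF this(1)]
  have "x 2 = x 0"
    using fun_cong[OF per, of 0] by (simp add: shift_def)
  then have nf: "\<not> forbidden A [x 0, x 1]" "\<not> forbidden A [x 1, x 0]"
    using nf[of 0] nf[of 1] by simp_all
  moreover have "\<And>i j. \<not> forbidden A [Alpha i, Beta j] \<Longrightarrow> i = j"
    and "\<And>i j. \<not> forbidden A [Beta i, Beta j] \<Longrightarrow> A i j \<noteq> 0"
    and "\<And>i j. \<not> forbidden A [Alpha j, Alpha i] \<Longrightarrow> A i j \<noteq> 0"
    using forbidden_two_letters[OF two, where A = A] by blast+
  ultimately show ?thesis
    by (cases "x 0"; cases "x 1") simp_all
qed

lemma card_two_periodic_le:
  fixes A :: "'i::finite \<Rightarrow> 'i \<Rightarrow> nat"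
  assumes two: "CARD('i) = 2"
  shows "finite (two_periodic (markov_dyck_shift A))"
    and "card (two_periodic (markov_dyck_shift A)) \<le> card {(a, b). dyck_pair A a b}"
proof -
  let ?f = "\<lambda>x :: int \<Rightarrow> 'i dyck_letter. (x 0, x 1)"
  have "inj_on ?f (two_periodic (markov_dyck_shift A))"
  proof (rule inj_onI)
    fix x y assume "x \<in> two_periodic (markov_dyck_shift A)" "y \<in> two_periodic (markov_dyck_shift A)"
      and "?f x = ?f y"
    then show "x = y"
      using two_periodic_eq_alternating[of x] two_periodic_eq_alternating[of y]
      by (simp add: two_periodic_def)
  qed
  moreover have "?f ` two_periodic (markov_dyck_shift A) \<subseteq> {(a, b). dyck_pair A a b}"
    using two_periodic_dyck_pair[OF two] by auto
  ultimately show "finite (two_periodic (markov_dyck_shift A))"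
    and "card (two_periodic (markov_dyck_shift A)) \<le> card {(a, b). dyck_pair A a b}"
    using finite_dyck_pair[of A] by (auto intro: inj_on_finite card_inj_on_le)
qed

theorem proposition5p1:
  shows "\<not> topologically_conjugate (vertex_shift G2) (edge_shift G2)"
proof
  let ?V = "vertex_matrix G2" and ?E = "edge_matrix G2"
  let ?X = "two_periodic (markov_dyck_shift ?V)" and ?Y = "two_periodic (markov_dyck_shift ?E)"
  assume "topologically_conjugate (vertex_shift G2) (edge_shift G2)"
  then have "topologically_conjugate (markov_dyck_shift ?V) (markov_dyck_shift ?E)"
    by (simp only: vertex_shift_def edge_shift_def)
  then obtain h where h: "bij_betw h ?X ?Y"
    by (rule topologically_conjugate_two_periodic[OF _ shift_in_markov_dyck_shift])
  have cards: "CARD(G2_vertex) = 2" "CARD(G2_edge) = 3"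
    by (simp_all add: UNIV_G2_vertex UNIV_G2_edge)
  have "?V i j \<noteq> 0 \<and> ?V j i \<noteq> 0 \<longleftrightarrow> (i, j) \<in> {(V1, V1), (V1, V2), (V2, V1)}" for i j
    by (cases i; cases j) (simp_all add: vertex_matrix_G2)
  then have "{(i, j). ?V i j \<noteq> 0 \<and> ?V j i \<noteq> 0} = {(V1, V1), (V1, V2), (V2, V1)}"
    by auto
  then have "card {(i, j). ?V i j \<noteq> 0 \<and> ?V j i \<noteq> 0} = 3"
    by simp
  then have V: "card {(a, b). dyck_pair ?V a b} = 10"
    by (simp add: card_dyck_pair cards)
  have "?E i j \<noteq> 0 \<and> ?E j i \<noteq> 0 \<longleftrightarrow> (i, j) \<in> {(E11, E11), (E12, E21), (E21, E12)}" for i j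
    by (cases i; cases j) (simp_all add: edge_matrix_G2)
  then have "{(i, j). ?E i j \<noteq> 0 \<and> ?E j i \<noteq> 0} = {(E11, E11), (E12, E21), (E21, E12)}"
    by auto
  then have "card {(i, j). ?E i j \<noteq> 0 \<and> ?E j i \<noteq> 0} = 3"
    by simp
  then have E: "card {(a, b). dyck_pair ?E a b} = 12"
    by (simp add: card_dyck_pair cards)
  have "?E i j \<le> 1" for i j
    by (simp add: edge_matrix_def)
  moreover have "\<exists>j. ?E i j \<noteq> 0" for i
    by (cases i) (metis edge_matrix_G2 zero_neq_one)+
  moreover have "finite ?Y"
    using h card_two_periodic_le(1)[OF cards(1)] bij_betw_finite by blast
  ultimately have "12 \<le> card ?Y"
    using card_two_periodic_ge[of ?E] E by simp
  moreover have "card ?X \<le> 10"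
    using card_two_periodic_le(2)[OF cards(1)] V by metis
  ultimately show False
    using bij_betw_same_card[OF h] by simp
qed

end
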